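(* Let $(L_i \mid i\in I)$ be a family of lattices which are disjoint except for a common sublattice $K$, which is convex in each $L_i$, and is a retract of each $L_i$ via a lattice-theoretic retraction $\rho_i\colon L_i\to K$. Let $P$ denote the partial lattice given by the union of the $L_i$ with amalgamation of the common sublattice $K$, and let $L=\mathrm{Free}_{\mathbf{V}} P$, where $\mathbf{V}$ is any variety of lattices containing all the $L_i$. Then for any lattice $M$ (not necessarily belonging to $\mathbf{V}$) given with isotone maps $\varphi_i\colon L_i\to M$ agreeing on $K$, there exists an isotone map $\varphi\colon L\to M$ extending all the $\varphi_i$. In other words, every isotone map $P\to M$ extends to $L$.
   Context: Lattices are nonempty. An isotone map is an order-preserving map. A sublattice $K$ of a lattice $N$ is convex if $a\le x\le b$ with $a,b\in K$, $x\in N$ implies $x\in K$. A lattice-theoretic retraction $\rho_i\colon L_i\to K$ is a lattice homomorphism restricting to the identity on $K$. "Disjoint except for $K$" means $L_i\cap L_j=K$ for $i\ne j$. The partial lattice $P$ is the set $\bigcup_i L_i$ with the meets and joins of the individual $L_i$; its order is the one generated by the orders of the $L_i$, so a map $P\to M$ is isotone iff its restriction to each $L_i$ is isotone. $\mathrm{Free}_{\mathbf{V}}P$ is the free lattice in $\mathbf{V}$ on $P$, i.e. the free product of the $L_i$ in $\mathbf{V}$ with amalgamation of $K$: a lattice in $\mathbf{V}$ with lattice homomorphisms $L_i\to \mathrm{Free}_{\mathbf{V}}P$ agreeing on $K$, universal among such families of homomorphisms to lattices in $\mathbf{V}$. "$\varphi$ extends $\varphi_i$" means that $\varphi$ composed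 with the canonical map $L_i\to L$ equals $\varphi_i$. *)

theory Defs
  imports "HOL-Algebra.Lattice"
begin

section \<open>Lattices, homomorphisms, convex sublattices\<close>

text \<open>The locale \<open>lattice\<close> admits an empty carrier; here lattices are nonempty.\<close>

definition is_lattice :: "'a gorder \<Rightarrow> bool" where
  "is_lattice N \<longleftrightarrow> lattice N \<and> carrier N \<noteq> {}"

definition lattice_hom :: "'a gorder \<Rightarrow> 'b gorder \<Rightarrow> ('a \<Rightarrow> 'b) \<Rightarrow> bool" where
  "lattice_hom A B f \<longleftrightarrow>
     f \<in> carrier A \<rightarrow> carrier B \<and> join_pres A B f \<and> meet_pres A B f"

text \<open>The library's \<open>isotone\<close> does not say that the map sends carrier to carrier.\<close>

definition isotone_map :: "'a gorder \<Rightarrow> 'b gorder \<Rightarrow> ('a \<Rightarrow> 'b) \<Rightarrow> bool" where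
  "isotone_map A B f \<longleftrightarrow> f \<in> carrier A \<rightarrow> carrier B \<and> isotone A B f"

definition sublattice :: "'a gorder \<Rightarrow> 'a gorder \<Rightarrow> bool" where
  "sublattice K N \<longleftrightarrow> is_lattice K \<and> is_lattice N \<and> carrier K \<subseteq> carrier N \<and>
     (\<forall>x\<in>carrier K. \<forall>y\<in>carrier K.
        (x \<sqsubseteq>\<^bsub>K\<^esub> y \<longleftrightarrow> x \<sqsubseteq>\<^bsub>N\<^esub> y) \<and>
        x \<squnion>\<^bsub>K\<^esub> y = x \<squnion>\<^bsub>N\<^esub> y \<and> x \<sqinter>\<^bsub>K\<^esub> y = x \<sqinter>\<^bsub>N\<^esub> y)"

definition convex_in :: "'a gorder \<Rightarrow> 'a gorder \<Rightarrow> bool" where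
  "convex_in K N \<longleftrightarrow>
     (\<forall>a\<in>carrier K. \<forall>b\<in>carrier K. \<forall>x\<in>carrier N.
        a \<sqsubseteq>\<^bsub>N\<^esub> x \<and> x \<sqsubseteq>\<^bsub>N\<^esub> b \<longrightarrow> x \<in> carrier K)"

definition lattice_retraction :: "'a gorder \<Rightarrow> 'a gorder \<Rightarrow> ('a \<Rightarrow> 'a) \<Rightarrow> bool" where
  "lattice_retraction N K r \<longleftrightarrow> lattice_hom N K r \<and> (\<forall>x\<in>carrier K. r x = x)"

section \<open>Varieties of lattices\<close>

datatype 'v lterm = LVar 'v | LJoin "'v lterm" "'v lterm" | LMeet "'v lterm" "'v lterm"

primrec leval :: "'a gorder \<Rightarrow> ('v \<Rightarrow> 'a) \<Rightarrow> 'v lterm \<Rightarrow> 'a" where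
  "leval N v (LVar x) = v x"
| "leval N v (LJoin s t) = leval N v s \<squnion>\<^bsub>N\<^esub> leval N v t"
| "leval N v (LMeet s t) = leval N v s \<sqinter>\<^bsub>N\<^esub> leval N v t"

text \<open>A variety is a proper class, ranging over lattices of all types. It is given by a set
  \<open>E\<close> of identities; an identity involves finitely many variables, so variables from
  \<open>nat\<close> suffice.\<close>

definition in_variety :: "(nat lterm \<times> nat lterm) set \<Rightarrow> 'a gorder \<Rightarrow> bool" where
  "in_variety E N \<longleftrightarrow> is_lattice N \<and>
     (\<forall>(s, t)\<in>E. \<forall>v. range v \<subseteq> carrier N \<longrightarrow> leval N v s = leval N v t)"

section \<open>The amalgam and the free lattice on it\<close>

definition disjoint_except_for :: "'i set \<Rightarrow> ('i \<Rightarrow> 'a gorder) \<Rightarrow> 'a gorder \<Rightarrow> bool" where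
  "disjoint_except_for I L K \<longleftrightarrow>
     (\<forall>i\<in>I. \<forall>j\<in>I. i \<noteq> j \<longrightarrow> carrier (L i) \<inter> carrier (L j) = carrier K)"

definition agree_on :: "'i set \<Rightarrow> 'a set \<Rightarrow> ('i \<Rightarrow> 'a \<Rightarrow> 'b) \<Rightarrow> bool" where
  "agree_on I A f \<longleftrightarrow> (\<forall>i\<in>I. \<forall>j\<in>I. \<forall>x\<in>A. f i x = f j x)"

text \<open>The partial lattice \<open>P\<close> as an ordered set, under the order generated by the orders
  of the \<open>L i\<close>; it is a partial order by \<open>amalgam_partial_order\<close> below.\<close>

definition amalgam :: "'i set \<Rightarrow> ('i \<Rightarrow> 'a gorder) \<Rightarrow> 'a gorder" where
  "amalgam I L =
     \<lparr>carrier = (\<Union>i\<in>I. carrier (L i)), eq = (=),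
      le = (\<lambda>x y. (x, y) \<in>
        {(x, y). \<exists>i\<in>I. x \<in> carrier (L i) \<and> y \<in> carrier (L i) \<and> x \<sqsubseteq>\<^bsub>L i\<^esub> y}\<^sup>+)\<rparr>"

definition universal_into ::
  "'n itself \<Rightarrow> (nat lterm \<times> nat lterm) set \<Rightarrow> 'i set \<Rightarrow> ('i \<Rightarrow> 'a gorder) \<Rightarrow> 'a gorder \<Rightarrow>
   'l gorder \<Rightarrow> ('i \<Rightarrow> 'a \<Rightarrow> 'l) \<Rightarrow> bool" where
  "universal_into (_ :: 'n itself) E I L K F \<eta> \<longleftrightarrow>
     (\<forall>(N :: 'n gorder) g.
        in_variety E N \<and> (\<forall>i\<in>I. lattice_hom (L i) N (g i)) \<and> agree_on I (carrier K) g \<longrightarrow>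
        (\<exists>h. lattice_hom F N h \<and> (\<forall>i\<in>I. \<forall>x\<in>carrier (L i). h (\<eta> i x) = g i x)) \<and>
        (\<forall>h h'. lattice_hom F N h \<and> (\<forall>i\<in>I. \<forall>x\<in>carrier (L i). h (\<eta> i x) = g i x) \<and>
                lattice_hom F N h' \<and> (\<forall>i\<in>I. \<forall>x\<in>carrier (L i). h' (\<eta> i x) = g i x) \<longrightarrow>
                (\<forall>x\<in>carrier F. h x = h' x)))"

text \<open>\<open>F\<close> with canonical maps \<open>\<eta> i\<close> is the free product of the \<open>L i\<close> in the variety with
  amalgamation of \<open>K\<close>. The universal property ranges over target lattices of all types, which
  a definition in HOL cannot say. It is required for the two target types \<open>'l\<close> (the type of
  \<open>F\<close>) and \<open>'a lterm set\<close> (the type of the quotient of the term algebra over \<open>P\<close>).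
  This implies the universal property for every target type, and such an \<open>F\<close> exists:
  see \<open>free_amalgam_universal\<close> and \<open>free_amalgam_exists\<close> below.\<close>

definition free_amalgam ::
  "(nat lterm \<times> nat lterm) set \<Rightarrow> 'i set \<Rightarrow> ('i \<Rightarrow> 'a gorder) \<Rightarrow> 'a gorder \<Rightarrow>
   'l gorder \<Rightarrow> ('i \<Rightarrow> 'a \<Rightarrow> 'l) \<Rightarrow> bool" where
  "free_amalgam E I L K F \<eta> \<longleftrightarrow>
     in_variety E F \<and> (\<forall>i\<in>I. lattice_hom (L i) F (\<eta> i)) \<and> agree_on I (carrier K) \<eta> \<and>
     universal_into TYPE('l) E I L K F \<eta> \<and>
     universal_into TYPE('a lterm set) E I L K F \<eta>"

section \<open>The order of the amalgam\<close>

lemma amalgam_le_iff: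
  assumes sub: "\<forall>i\<in>I. sublattice K (L i)"
    and disj: "disjoint_except_for I L K"
  shows "x \<sqsubseteq>\<^bsub>amalgam I L\<^esub> y \<longleftrightarrow>
    (\<exists>i\<in>I. \<exists>j\<in>I. \<exists>k. x \<in> carrier (L i) \<and> y \<in> carrier (L j) \<and>
       k \<in> carrier (L i) \<and> k \<in> carrier (L j) \<and> x \<sqsubseteq>\<^bsub>L i\<^esub> k \<and> k \<sqsubseteq>\<^bsub>L j\<^esub> y)"
    (is "_ \<longleftrightarrow> ?R x y")
proof -
  let ?r = "{(x, y). \<exists>i\<in>I. x \<in> carrier (L i) \<and> y \<in> carrier (L i) \<and> x \<sqsubseteq>\<^bsub>L i\<^esub> y}"
  have lat: "lattice (L i)" if "i \<in> I" for i
    using sub[rule_format, OF that] by (simp add: sublattice_def is_lattice_def)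
  have po: "partial_order (L i)" if "i \<in> I" for i
    using lat[OF that] lattice.axioms(1) upper_semilattice.axioms(1) by blast
  have rfl: "x \<sqsubseteq>\<^bsub>L i\<^esub> x" if "i \<in> I" "x \<in> carrier (L i)" for i x
    using partial_order.axioms(1)[OF po[OF that(1)]] that(2)
    by (simp add: weak_partial_order.le_refl)
  have trs: "x \<sqsubseteq>\<^bsub>L i\<^esub> z" if "i \<in> I" "x \<in> carrier (L i)" "y \<in> carrier (L i)"
      "z \<in> carrier (L i)" "x \<sqsubseteq>\<^bsub>L i\<^esub> y" "y \<sqsubseteq>\<^bsub>L i\<^esub> z" for i x y z
    using weak_partial_order.le_trans[OF partial_order.axioms(1)[OF po[OF that(1)]]] that(2-)
    by blast
  have Ksub: "carrier K \<subseteq> carrier (L i)" if "i \<in> I" for i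
    using sub[rule_format, OF that] by (simp add: sublattice_def)
  have Kle: "a \<sqsubseteq>\<^bsub>L j\<^esub> b" if "i \<in> I" "j \<in> I" "a \<in> carrier K" "b \<in> carrier K" "a \<sqsubseteq>\<^bsub>L i\<^esub> b" for i j a b
    using sub[rule_format, OF that(1)] sub[rule_format, OF that(2)] that(3-) by (auto simp: sublattice_def)
  have inK: "a \<in> carrier K" if "i \<in> I" "j \<in> I" "i \<noteq> j" "a \<in> carrier (L i)" "a \<in> carrier (L j)" for i j a
    using disj that unfolding disjoint_except_for_def by blast
  have extend: "?R x z" if "?R x y" "(y, z) \<in> ?r" for x y z
  proof -
    from that(1) obtain i j k where 1: "i \<in> I" "j \<in> I" "x \<in> carrier (L i)" "y \<in> carrier (L j)"
      "k \<in> carrier (L i)" "k \<in> carrier (L j)" "x \<sqsubseteq>\<^bsub>L i\<^esub> k" "k \<sqsubseteq>\<^bsub>L j\<^esub> y" by blast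
    from that(2) obtain l where 2: "l \<in> I" "y \<in> carrier (L l)" "z \<in> carrier (L l)" "y \<sqsubseteq>\<^bsub>L l\<^esub> z"
      by blast
    show ?thesis
    proof (cases "l = j")
      case True
      with 1 2 trs[of j k y z] show ?thesis by blast
    next
      case False
      then have yK: "y \<in> carrier K" using inK[of l j y] 1 2 by blast
      show ?thesis
      proof (cases "i = j")
        case True
        with 1 trs[of i x k y] have "x \<sqsubseteq>\<^bsub>L i\<^esub> y" by blast
        with True 1 2 show ?thesis by blast
      next
        case False
        then have kK: "k \<in> carrier K" using inK[of i j k] 1 by blast
        have "k \<sqsubseteq>\<^bsub>L i\<^esub> y" using Kle[of j i k y] kK yK 1 by blast
        then have "x \<sqsubseteq>\<^bsub>L i\<^esub> y" using trs[of i x k y] 1 Ksub[of i] yK by blast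
        then show ?thesis using 1 2 Ksub[of i] yK by blast
      qed
    qed
  qed
  have "?R x y" if "(x, y) \<in> ?r\<^sup>+"
    using that
  proof (induction rule: trancl_induct)
    case (base y)
    then show ?case using rfl by blast
  next
    case (step y z)
    show ?case by (rule extend[OF step.IH step.hyps(2)])
  qed
  moreover have "(x, y) \<in> ?r\<^sup>+" if "?R x y"
  proof -
    from that obtain k where "(x, k) \<in> ?r" "(k, y) \<in> ?r" by blast
    then show ?thesis by (meson trancl.simps)
  qed
  ultimately show ?thesis by (auto simp: amalgam_def)
qed

lemma amalgam_partial_order:
  assumes sub: "\<forall>i\<in>I. sublattice K (L i)"
    and conv: "\<forall>i\<in>I. convex_in K (L i)"
    and disj: "disjoint_except_for I L K"
  shows "partial_order (amalgam I L)"
proof -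
  note le_iff = amalgam_le_iff[OF sub disj]
  have lat: "lattice (L i)" if "i \<in> I" for i
    using sub[rule_format, OF that] by (simp add: sublattice_def is_lattice_def)
  have po: "partial_order (L i)" if "i \<in> I" for i
    using lat[OF that] lattice.axioms(1) upper_semilattice.axioms(1) by blast
  have rfl: "x \<sqsubseteq>\<^bsub>L i\<^esub> x" if "i \<in> I" "x \<in> carrier (L i)" for i x
    using partial_order.axioms(1)[OF po[OF that(1)]] that(2)
    by (simp add: weak_partial_order.le_refl)
  have trs: "x \<sqsubseteq>\<^bsub>L i\<^esub> z" if "i \<in> I" "x \<in> carrier (L i)" "y \<in> carrier (L i)"
      "z \<in> carrier (L i)" "x \<sqsubseteq>\<^bsub>L i\<^esub> y" "y \<sqsubseteq>\<^bsub>L i\<^esub> z" for i x y z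
    using weak_partial_order.le_trans[OF partial_order.axioms(1)[OF po[OF that(1)]]] that(2-)
    by blast
  have asym: "x = y" if "i \<in> I" "x \<in> carrier (L i)" "y \<in> carrier (L i)"
      "x \<sqsubseteq>\<^bsub>L i\<^esub> y" "y \<sqsubseteq>\<^bsub>L i\<^esub> x" for i x y
    using partial_order.le_antisym[OF po[OF that(1)]] that(2-) by blast
  have Kle: "a \<sqsubseteq>\<^bsub>L j\<^esub> b" if "i \<in> I" "j \<in> I" "a \<in> carrier K" "b \<in> carrier K" "a \<sqsubseteq>\<^bsub>L i\<^esub> b" for i j a b
    using sub[rule_format, OF that(1)] sub[rule_format, OF that(2)] that(3-) by (auto simp: sublattice_def)
  have Ksub: "carrier K \<subseteq> carrier (L i)" if "i \<in> I" for i
    using sub[rule_format, OF that] by (simp add: sublattice_def)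
  have inK: "a \<in> carrier K" if "i \<in> I" "j \<in> I" "i \<noteq> j" "a \<in> carrier (L i)" "a \<in> carrier (L j)" for i j a
    using disj that unfolding disjoint_except_for_def by blast
  have same: "x \<sqsubseteq>\<^bsub>L i\<^esub> y" if "x \<sqsubseteq>\<^bsub>amalgam I L\<^esub> y" "i \<in> I" "x \<in> carrier (L i)" "y \<in> carrier (L i)" for i x y
  proof -
    from that(1) obtain p q k where 1: "p \<in> I" "q \<in> I" "x \<in> carrier (L p)" "y \<in> carrier (L q)"
      "k \<in> carrier (L p)" "k \<in> carrier (L q)" "x \<sqsubseteq>\<^bsub>L p\<^esub> k" "k \<sqsubseteq>\<^bsub>L q\<^esub> y"
      unfolding le_iff by blast
    consider "p = i" "q = i" | "p = i" "q \<noteq> i" | "p \<noteq> i" "q = i" | "p \<noteq> i" "q \<noteq> i" by blast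
    then show ?thesis
    proof cases
      case 1 with \<open>x \<sqsubseteq>\<^bsub>L p\<^esub> k\<close> show ?thesis
        using trs[of i x k y] that \<open>k \<sqsubseteq>\<^bsub>L q\<^esub> y\<close> \<open>k \<in> carrier (L p)\<close> by blast
    next
      case 2
      then have "k \<in> carrier K" "y \<in> carrier K" using inK 1 that by blast+
      then have "k \<sqsubseteq>\<^bsub>L i\<^esub> y" using Kle[of q i k y] 1 that by blast
      then show ?thesis using trs[of i x k y] that 1 2 by blast
    next
      case 3
      then have "k \<in> carrier K" "x \<in> carrier K" using inK 1 that by blast+
      then have "x \<sqsubseteq>\<^bsub>L i\<^esub> k" using Kle[of p i x k] 1 that by blast
      then show ?thesis using trs[of i x k y] that 1 3 by blast
    next
      case 4
      then have xy: "x \<in> carrier K" "y \<in> carrier K" using inK 1 that by blast+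
      have k: "k \<in> carrier K"
      proof (cases "p = q")
        case True
        then show ?thesis using bspec[OF conv, of p] 1 xy unfolding convex_in_def by blast
      next
        case False
        then show ?thesis using inK 1 by blast
      qed
      have "x \<sqsubseteq>\<^bsub>L i\<^esub> k" "k \<sqsubseteq>\<^bsub>L i\<^esub> y" using Kle[of p i x k] Kle[of q i k y] 1 that xy k by blast+
      then show ?thesis using trs[of i x k y] that k Ksub[of i] by blast
    qed
  qed
  have T: "x \<sqsubseteq>\<^bsub>amalgam I L\<^esub> z" if "x \<sqsubseteq>\<^bsub>amalgam I L\<^esub> y" "y \<sqsubseteq>\<^bsub>amalgam I L\<^esub> z" for x y z
    using that unfolding amalgam_def by simp
  have A: "x = y" if xy: "x \<sqsubseteq>\<^bsub>amalgam I L\<^esub> y" and yx: "y \<sqsubseteq>\<^bsub>amalgam I L\<^esub> x" for x y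
  proof -
    from xy obtain i j k where 1: "i \<in> I" "j \<in> I" "x \<in> carrier (L i)" "y \<in> carrier (L j)"
      "k \<in> carrier (L i)" "k \<in> carrier (L j)" "x \<sqsubseteq>\<^bsub>L i\<^esub> k" "k \<sqsubseteq>\<^bsub>L j\<^esub> y"
      unfolding le_iff by blast
    have xk: "x \<sqsubseteq>\<^bsub>amalgam I L\<^esub> k" and ky: "k \<sqsubseteq>\<^bsub>amalgam I L\<^esub> y"
      unfolding le_iff using 1 rfl by blast+
    have "k \<sqsubseteq>\<^bsub>L i\<^esub> x" by (rule same[OF T[OF ky yx]]) (use 1 in auto)
    then have "x = k" using asym[of i x k] 1 by blast
    moreover have "y \<sqsubseteq>\<^bsub>L j\<^esub> k" by (rule same[OF T[OF yx xk]]) (use 1 in auto)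
    then have "y = k" using asym[of j y k] 1 by blast
    ultimately show ?thesis by simp
  qed
  show ?thesis
  proof
    fix x assume "x \<in> carrier (amalgam I L)"
    then obtain i where "i \<in> I" "x \<in> carrier (L i)" by (auto simp: amalgam_def)
    then show "x \<sqsubseteq>\<^bsub>amalgam I L\<^esub> x" unfolding le_iff using rfl by blast
  next
    show "x .=\<^bsub>amalgam I L\<^esub> y" if "x \<sqsubseteq>\<^bsub>amalgam I L\<^esub> y" "y \<sqsubseteq>\<^bsub>amalgam I L\<^esub> x" for x y
      using A[OF that] by (simp add: amalgam_def)
  next
    show "x \<sqsubseteq>\<^bsub>amalgam I L\<^esub> z" if "x \<sqsubseteq>\<^bsub>amalgam I L\<^esub> y" "y \<sqsubseteq>\<^bsub>amalgam I L\<^esub> z" for x y z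
      by (rule T[OF that])
  qed (auto simp: amalgam_def)
qed

section \<open>Existence and universality of the free amalgam\<close>

lemma lattice_from_operations:
  fixes C :: "'b set"
  assumes j: "\<And>x y. x \<in> C \<Longrightarrow> y \<in> C \<Longrightarrow> j x y \<in> C"
    and m: "\<And>x y. x \<in> C \<Longrightarrow> y \<in> C \<Longrightarrow> m x y \<in> C"
    and jc: "\<And>x y. x \<in> C \<Longrightarrow> y \<in> C \<Longrightarrow> j x y = j y x"
    and mc: "\<And>x y. x \<in> C \<Longrightarrow> y \<in> C \<Longrightarrow> m x y = m y x"
    and ja: "\<And>x y z. x \<in> C \<Longrightarrow> y \<in> C \<Longrightarrow> z \<in> C \<Longrightarrow> j (j x y) z = j x (j y z)"
    and ma: "\<And>x y z. x \<in> C \<Longrightarrow> y \<in> C \<Longrightarrow> z \<in> C \<Longrightarrow> m (m x y) z = m x (m y z)"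
    and jm: "\<And>x y. x \<in> C \<Longrightarrow> y \<in> C \<Longrightarrow> j x (m x y) = x"
    and mj: "\<And>x y. x \<in> C \<Longrightarrow> y \<in> C \<Longrightarrow> m x (j x y) = x"
  defines "N \<equiv> \<lparr>carrier = C, eq = (=), le = (\<lambda>x y. j x y = y)\<rparr>"
  shows "lattice N"
    and "x \<in> C \<Longrightarrow> y \<in> C \<Longrightarrow> x \<squnion>\<^bsub>N\<^esub> y = j x y"
    and "x \<in> C \<Longrightarrow> y \<in> C \<Longrightarrow> x \<sqinter>\<^bsub>N\<^esub> y = m x y"
proof -
  have idem: "j x x = x" if "x \<in> C" for x using jm mj j m that by metis
  have po: "partial_order N"
  proof
    show "x .=\<^bsub>N\<^esub> y" if "x \<sqsubseteq>\<^bsub>N\<^esub> y" "y \<sqsubseteq>\<^bsub>N\<^esub> x" "x \<in> carrier N" "y \<in> carrier N" for x y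
      using that jc[of x y] by (simp add: N_def)
    show "x \<sqsubseteq>\<^bsub>N\<^esub> z" if "x \<sqsubseteq>\<^bsub>N\<^esub> y" "y \<sqsubseteq>\<^bsub>N\<^esub> z" "x \<in> carrier N" "y \<in> carrier N" "z \<in> carrier N" for x y z
      using that ja[of x y z] by (simp add: N_def)
  qed (auto simp: N_def idem)
  interpret partial_order N by (rule po)
  have lem: "j x y = y \<longleftrightarrow> m x y = x" if "x \<in> C" "y \<in> C" for x y
    using that jm mj jc mc by metis
  have sup: "least N (j x y) (Upper N {x, y})" if "x \<in> C" "y \<in> C" for x y
  proof (rule least_UpperI)
    fix z assume "z \<in> {x, y}"
    then show "z \<sqsubseteq>\<^bsub>N\<^esub> j x y"
      using that ja idem jc j by (auto simp: N_def) metis+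
  next
    fix z assume "z \<in> Upper N {x, y}"
    then have "z \<in> C" "j x z = z" "j y z = z" using that by (auto simp: Upper_def N_def)
    then show "j x y \<sqsubseteq>\<^bsub>N\<^esub> z" using that ja[of x y z] by (simp add: N_def)
  qed (use that j in \<open>auto simp: N_def\<close>)
  have inf: "greatest N (m x y) (Lower N {x, y})" if "x \<in> C" "y \<in> C" for x y
  proof (rule greatest_LowerI)
    fix z assume "z \<in> {x, y}"
    then show "m x y \<sqsubseteq>\<^bsub>N\<^esub> z"
      using that jm[of x y] jm[of y x] jc[of x "m x y"] jc[of y "m x y"] mc[of x y] m[of x y]
      by (auto simp: N_def)
  next
    fix z assume "z \<in> Lower N {x, y}"
    then have z: "z \<in> C" "j z x = x" "j z y = y" using that by (auto simp: Lower_def N_def)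
    then have "m z x = z" "m z y = z" using lem that by auto
    then have "m z (m x y) = z" using ma[of z x y] z that by simp
    then show "z \<sqsubseteq>\<^bsub>N\<^esub> m x y" using lem[of z "m x y"] z that m by (simp add: N_def)
  qed (use that m in \<open>auto simp: N_def\<close>)
  show L: "lattice N"
  proof
    show "\<exists>s. least N s (Upper N {x, y})" if "x \<in> carrier N" "y \<in> carrier N" for x y
      using sup[of x y] that by (auto simp: N_def)
    show "\<exists>s. greatest N s (Lower N {x, y})" if "x \<in> carrier N" "y \<in> carrier N" for x y
      using inf[of x y] that by (auto simp: N_def)
  qed
  show "x \<squnion>\<^bsub>N\<^esub> y = j x y" if "x \<in> C" "y \<in> C"
    unfolding join_def sup_def
    by (rule some_equality[where P = "\<lambda>s. least N s (Upper N {x, y})", OF sup[OF that]])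
      (rule least_unique[OF _ sup[OF that]])
  show "x \<sqinter>\<^bsub>N\<^esub> y = m x y" if "x \<in> C" "y \<in> C"
    unfolding meet_def inf_def
    by (rule some_equality[where P = "\<lambda>s. greatest N s (Lower N {x, y})", OF inf[OF that]])
      (rule greatest_unique[OF _ inf[OF that]])
qed

lemma lattice_laws:
  assumes "lattice N" "x \<in> carrier N" "y \<in> carrier N"
  shows "x \<squnion>\<^bsub>N\<^esub> y \<in> carrier N" "x \<sqinter>\<^bsub>N\<^esub> y \<in> carrier N"
    "x \<squnion>\<^bsub>N\<^esub> y = y \<squnion>\<^bsub>N\<^esub> x" "x \<sqinter>\<^bsub>N\<^esub> y = y \<sqinter>\<^bsub>N\<^esub> x"
    "x \<squnion>\<^bsub>N\<^esub> (x \<sqinter>\<^bsub>N\<^esub> y) = x" "x \<sqinter>\<^bsub>N\<^esub> (x \<squnion>\<^bsub>N\<^esub> y) = x"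
    "z \<in> carrier N \<Longrightarrow> (x \<squnion>\<^bsub>N\<^esub> y) \<squnion>\<^bsub>N\<^esub> z = x \<squnion>\<^bsub>N\<^esub> (y \<squnion>\<^bsub>N\<^esub> z)"
    "z \<in> carrier N \<Longrightarrow> (x \<sqinter>\<^bsub>N\<^esub> y) \<sqinter>\<^bsub>N\<^esub> z = x \<sqinter>\<^bsub>N\<^esub> (y \<sqinter>\<^bsub>N\<^esub> z)"
proof -
  interpret lattice N by fact
  show "x \<squnion>\<^bsub>N\<^esub> y \<in> carrier N" "x \<sqinter>\<^bsub>N\<^esub> y \<in> carrier N" using assms by auto
  show "x \<squnion>\<^bsub>N\<^esub> y = y \<squnion>\<^bsub>N\<^esub> x" by (rule join_comm)
  show "x \<sqinter>\<^bsub>N\<^esub> y = y \<sqinter>\<^bsub>N\<^esub> x" by (rule meet_comm)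
  show "(x \<squnion>\<^bsub>N\<^esub> y) \<squnion>\<^bsub>N\<^esub> z = x \<squnion>\<^bsub>N\<^esub> (y \<squnion>\<^bsub>N\<^esub> z)" if "z \<in> carrier N"
    using weak_join_assoc[of x y z] assms that by (simp add: eq_is_equal)
  show "(x \<sqinter>\<^bsub>N\<^esub> y) \<sqinter>\<^bsub>N\<^esub> z = x \<sqinter>\<^bsub>N\<^esub> (y \<sqinter>\<^bsub>N\<^esub> z)" if "z \<in> carrier N"
    using weak_meet_assoc[of x y z] assms that by (simp add: eq_is_equal)
  have "x \<sqinter>\<^bsub>N\<^esub> y \<sqsubseteq>\<^bsub>N\<^esub> x" using assms by (simp add: meet_left)
  then show "x \<squnion>\<^bsub>N\<^esub> (x \<sqinter>\<^bsub>N\<^esub> y) = x"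
    using le_iff_meet[of "x \<sqinter>\<^bsub>N\<^esub> y" x] assms join_comm[of N x "x \<sqinter>\<^bsub>N\<^esub> y"] by simp
  have "x \<sqsubseteq>\<^bsub>N\<^esub> x \<squnion>\<^bsub>N\<^esub> y" using assms by (simp add: join_left)
  then show "x \<sqinter>\<^bsub>N\<^esub> (x \<squnion>\<^bsub>N\<^esub> y) = x" using le_iff_join[of x "x \<squnion>\<^bsub>N\<^esub> y"] assms by simp
qed

primrec lsubst :: "('v \<Rightarrow> 'a lterm) \<Rightarrow> 'v lterm \<Rightarrow> 'a lterm" where
  "lsubst \<sigma> (LVar x) = \<sigma> x"
| "lsubst \<sigma> (LJoin s t) = LJoin (lsubst \<sigma> s) (lsubst \<sigma> t)"
| "lsubst \<sigma> (LMeet s t) = LMeet (lsubst \<sigma> s) (lsubst \<sigma> t)"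

inductive tcong ::
  "(nat lterm \<times> nat lterm) set \<Rightarrow> 'i set \<Rightarrow> ('i \<Rightarrow> 'a gorder) \<Rightarrow> 'a lterm \<Rightarrow> 'a lterm \<Rightarrow> bool"
  for E I L where
  refl: "tcong E I L s s"
| sym: "tcong E I L s t \<Longrightarrow> tcong E I L t s"
| trans: "tcong E I L s t \<Longrightarrow> tcong E I L t u \<Longrightarrow> tcong E I L s u"
| cong_join: "tcong E I L s s' \<Longrightarrow> tcong E I L t t' \<Longrightarrow> tcong E I L (LJoin s t) (LJoin s' t')"
| cong_meet: "tcong E I L s s' \<Longrightarrow> tcong E I L t t' \<Longrightarrow> tcong E I L (LMeet s t) (LMeet s' t')"
| join_commute: "tcong E I L (LJoin s t) (LJoin t s)"
| meet_commute: "tcong E I L (LMeet s t) (LMeet t s)"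
| join_assoc: "tcong E I L (LJoin (LJoin s t) u) (LJoin s (LJoin t u))"
| meet_assoc: "tcong E I L (LMeet (LMeet s t) u) (LMeet s (LMeet t u))"
| join_absorb: "tcong E I L (LJoin s (LMeet s t)) s"
| meet_absorb: "tcong E I L (LMeet s (LJoin s t)) s"
| identity: "(s, t) \<in> E \<Longrightarrow> tcong E I L (lsubst \<sigma> s) (lsubst \<sigma> t)"
| join_rel: "i \<in> I \<Longrightarrow> x \<in> carrier (L i) \<Longrightarrow> y \<in> carrier (L i) \<Longrightarrow>
    tcong E I L (LJoin (LVar x) (LVar y)) (LVar (x \<squnion>\<^bsub>L i\<^esub> y))"
| meet_rel: "i \<in> I \<Longrightarrow> x \<in> carrier (L i) \<Longrightarrow> y \<in> carrier (L i) \<Longrightarrow>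
    tcong E I L (LMeet (LVar x) (LVar y)) (LVar (x \<sqinter>\<^bsub>L i\<^esub> y))"

definition tclass :: "(nat lterm \<times> nat lterm) set \<Rightarrow> 'i set \<Rightarrow> ('i \<Rightarrow> 'a gorder) \<Rightarrow> 'a lterm \<Rightarrow> 'a lterm set"
  where "tclass E I L s = {t. tcong E I L s t}"

definition tjoin :: "(nat lterm \<times> nat lterm) set \<Rightarrow> 'i set \<Rightarrow> ('i \<Rightarrow> 'a gorder) \<Rightarrow>
    'a lterm set \<Rightarrow> 'a lterm set \<Rightarrow> 'a lterm set"
  where "tjoin E I L X Y = {u. \<exists>s\<in>X. \<exists>t\<in>Y. tcong E I L (LJoin s t) u}"

definition tmeet :: "(nat lterm \<times> nat lterm) set \<Rightarrow> 'i set \<Rightarrow> ('i \<Rightarrow> 'a gorder) \<Rightarrow>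
    'a lterm set \<Rightarrow> 'a lterm set \<Rightarrow> 'a lterm set"
  where "tmeet E I L X Y = {u. \<exists>s\<in>X. \<exists>t\<in>Y. tcong E I L (LMeet s t) u}"

definition term_lattice ::
  "(nat lterm \<times> nat lterm) set \<Rightarrow> 'i set \<Rightarrow> ('i \<Rightarrow> 'a gorder) \<Rightarrow> 'a lterm set gorder" where
  "term_lattice E I L =
     \<lparr>carrier = tclass E I L ` {t. set_lterm t \<subseteq> (\<Union>i\<in>I. carrier (L i))}, eq = (=),
      le = (\<lambda>X Y. tjoin E I L X Y = Y)\<rparr>"

lemma tclass_eq_iff: "tclass E I L s = tclass E I L t \<longleftrightarrow> tcong E I L s t"
  unfolding tclass_def by (blast intro: tcong.refl tcong.sym tcong.trans)

lemma tjoin_tclass [simp]: "tjoin E I L (tclass E I L s) (tclass E I L t) = tclass E I L (LJoin s t)"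
  unfolding tclass_def tjoin_def by (blast intro: tcong.refl tcong.trans tcong.cong_join)

lemma tmeet_tclass [simp]: "tmeet E I L (tclass E I L s) (tclass E I L t) = tclass E I L (LMeet s t)"
  unfolding tclass_def tmeet_def by (blast intro: tcong.refl tcong.trans tcong.cong_meet)

lemma term_lattice:
  fixes L :: "'i \<Rightarrow> 'a gorder" and I :: "'i set" and E :: "(nat lterm \<times> nat lterm) set"
  defines "T \<equiv> term_lattice E I L"
  shows "lattice T"
    and "X \<in> carrier T \<Longrightarrow> Y \<in> carrier T \<Longrightarrow> X \<squnion>\<^bsub>T\<^esub> Y = tjoin E I L X Y"
    and "X \<in> carrier T \<Longrightarrow> Y \<in> carrier T \<Longrightarrow> X \<sqinter>\<^bsub>T\<^esub> Y = tmeet E I L X Y"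
proof -
  let ?C = "tclass E I L ` {t. set_lterm t \<subseteq> (\<Union>i\<in>I. carrier (L i))}"
  have ax:
    "\<And>x y. x \<in> ?C \<Longrightarrow> y \<in> ?C \<Longrightarrow> tjoin E I L x y \<in> ?C"
    "\<And>x y. x \<in> ?C \<Longrightarrow> y \<in> ?C \<Longrightarrow> tmeet E I L x y \<in> ?C"
    "\<And>x y. x \<in> ?C \<Longrightarrow> y \<in> ?C \<Longrightarrow> tjoin E I L x y = tjoin E I L y x"
    "\<And>x y. x \<in> ?C \<Longrightarrow> y \<in> ?C \<Longrightarrow> tmeet E I L x y = tmeet E I L y x"
    "\<And>x y z. x \<in> ?C \<Longrightarrow> y \<in> ?C \<Longrightarrow> z \<in> ?C \<Longrightarrow>
       tjoin E I L (tjoin E I L x y) z = tjoin E I L x (tjoin E I L y z)"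
    "\<And>x y z. x \<in> ?C \<Longrightarrow> y \<in> ?C \<Longrightarrow> z \<in> ?C \<Longrightarrow>
       tmeet E I L (tmeet E I L x y) z = tmeet E I L x (tmeet E I L y z)"
    "\<And>x y. x \<in> ?C \<Longrightarrow> y \<in> ?C \<Longrightarrow> tjoin E I L x (tmeet E I L x y) = x"
    "\<And>x y. x \<in> ?C \<Longrightarrow> y \<in> ?C \<Longrightarrow> tmeet E I L x (tjoin E I L x y) = x"
    subgoal by (elim imageE, hypsubst, simp only: tjoin_tclass, rule imageI, auto)
    subgoal by (elim imageE, hypsubst, simp only: tmeet_tclass, rule imageI, auto)
    by (elim imageE; simp add: tclass_eq_iff tcong.join_commute tcong.meet_commute
          tcong.join_assoc tcong.meet_assoc tcong.join_absorb tcong.meet_absorb)+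
  have "T = \<lparr>carrier = ?C, eq = (=), le = (\<lambda>X Y. tjoin E I L X Y = Y)\<rparr>"
    by (simp add: T_def term_lattice_def)
  with lattice_from_operations[of ?C "tjoin E I L" "tmeet E I L", OF ax]
  show "lattice T"
    and "X \<in> carrier T \<Longrightarrow> Y \<in> carrier T \<Longrightarrow> X \<squnion>\<^bsub>T\<^esub> Y = tjoin E I L X Y"
    and "X \<in> carrier T \<Longrightarrow> Y \<in> carrier T \<Longrightarrow> X \<sqinter>\<^bsub>T\<^esub> Y = tmeet E I L X Y"
    by simp_all
qed

lemma leval_closed:
  assumes "lattice N" "range v \<subseteq> carrier N"
  shows "leval N v t \<in> carrier N"
  using assms by (induction t) (auto simp: lattice_laws)

lemma leval_lsubst: "leval N v (lsubst \<sigma> t) = leval N (\<lambda>x. leval N v (\<sigma> x)) t"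
  by (induction t) auto

lemma tcong_sound:
  assumes N: "in_variety E N" and v: "range v \<subseteq> carrier N"
    and hom: "\<And>i x y. i \<in> I \<Longrightarrow> x \<in> carrier (L i) \<Longrightarrow> y \<in> carrier (L i) \<Longrightarrow>
      v (x \<squnion>\<^bsub>L i\<^esub> y) = v x \<squnion>\<^bsub>N\<^esub> v y \<and> v (x \<sqinter>\<^bsub>L i\<^esub> y) = v x \<sqinter>\<^bsub>N\<^esub> v y"
    and st: "tcong E I L s t"
  shows "leval N v s = leval N v t"
proof -
  have lat: "lattice N" using N by (simp add: in_variety_def is_lattice_def)
  note cl = leval_closed[OF lat v]
  note laws = lattice_laws[OF lat cl cl]
  from st show ?thesis
  proof (induction rule: tcong.induct)
    case (identity s t \<sigma>)
    have "range (\<lambda>x. leval N v (\<sigma> x)) \<subseteq> carrier N" using cl by blast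
    then show ?case using N identity unfolding leval_lsubst in_variety_def by blast
  qed (use laws(3-6) laws(7-8)[OF cl] hom in simp_all)
qed

lemma lattice_homD:
  assumes "lattice_hom A B f" "x \<in> carrier A" "y \<in> carrier A"
  shows "f x \<in> carrier B" "f (x \<squnion>\<^bsub>A\<^esub> y) = f x \<squnion>\<^bsub>B\<^esub> f y" "f (x \<sqinter>\<^bsub>A\<^esub> y) = f x \<sqinter>\<^bsub>B\<^esub> f y"
  using assms by (auto simp: lattice_hom_def join_pres_def meet_pres_def)

lemma lattice_hom_lattice: "lattice_hom A B f \<Longrightarrow> lattice A \<and> lattice B"
  by (simp add: lattice_hom_def join_pres_def)

lemma lattice_homI:
  assumes "lattice A" "lattice B" "\<And>x. x \<in> carrier A \<Longrightarrow> f x \<in> carrier B"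
    "\<And>x y. x \<in> carrier A \<Longrightarrow> y \<in> carrier A \<Longrightarrow>
      f (x \<squnion>\<^bsub>A\<^esub> y) = f x \<squnion>\<^bsub>B\<^esub> f y \<and> f (x \<sqinter>\<^bsub>A\<^esub> y) = f x \<sqinter>\<^bsub>B\<^esub> f y"
  shows "lattice_hom A B f"
  using assms by (auto simp: lattice_hom_def join_pres_def meet_pres_def)

lemma lattice_hom_comp:
  assumes "lattice_hom A B f" "lattice_hom B C g"
  shows "lattice_hom A C (\<lambda>x. g (f x))"
proof (rule lattice_homI)
  show "lattice A" "lattice C" using assms lattice_hom_lattice by blast+
  show "g (f x) \<in> carrier C" if "x \<in> carrier A" for x
    using lattice_homD(1)[OF assms(1) that that] lattice_homD(1)[OF assms(2)] by blast
  show "g (f (x \<squnion>\<^bsub>A\<^esub> y)) = g (f x) \<squnion>\<^bsub>C\<^esub> g (f y) \<and>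
      g (f (x \<sqinter>\<^bsub>A\<^esub> y)) = g (f x) \<sqinter>\<^bsub>C\<^esub> g (f y)"
    if xy: "x \<in> carrier A" "y \<in> carrier A" for x y
    using lattice_homD[OF assms(1) xy] lattice_homD(1)[OF assms(1) xy(2,2)]
      lattice_homD(2,3)[OF assms(2)] by simp
qed

lemma term_lattice_in_variety:
  assumes "I \<noteq> {}" and L: "\<forall>i\<in>I. is_lattice (L i)"
  shows "in_variety E (term_lattice E I L)"
proof -
  let ?T = "term_lattice E I L"
  obtain i x where "i \<in> I" "x \<in> carrier (L i)" using assms by (fastforce simp: is_lattice_def)
  then have "tclass E I L (LVar x) \<in> carrier ?T" by (auto simp: term_lattice_def intro!: imageI)
  then have ne: "carrier ?T \<noteq> {}" by blast
  have "leval ?T v s = leval ?T v t" if "(s, t) \<in> E" "range v \<subseteq> carrier ?T" for s t v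
  proof -
    have "\<forall>x. \<exists>u. set_lterm u \<subseteq> (\<Union>i\<in>I. carrier (L i)) \<and> v x = tclass E I L u"
      using that(2) unfolding term_lattice_def by (auto simp: image_subset_iff image_iff)
    then obtain \<sigma> where \<sigma>: "\<And>x. v x = tclass E I L (\<sigma> x)" by metis
    note cl = leval_closed[OF term_lattice(1) that(2)]
    have "leval ?T v u = tclass E I L (lsubst \<sigma> u)" for u
    proof (induction u)
      case (LVar x)
      then show ?case by (simp add: \<sigma>)
    next
      case (LJoin u w)
      then show ?case
        using term_lattice(2)[OF cl[of u] cl[of w]] by simp
    next
      case (LMeet u w)
      then show ?case
        using term_lattice(3)[OF cl[of u] cl[of w]] by simp
    qed
    then show ?thesis using tcong.identity[OF that(1)] by (simp add: tclass_eq_iff)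
  qed
  then show ?thesis using ne term_lattice(1) by (auto simp: in_variety_def is_lattice_def)
qed

lemma term_lattice_hom:
  assumes "i \<in> I" "is_lattice (L i)"
  shows "lattice_hom (L i) (term_lattice E I L) (\<lambda>x. tclass E I L (LVar x))"
proof (rule lattice_homI)
  show "lattice (L i)" using assms by (simp add: is_lattice_def)
  have car: "tclass E I L (LVar x) \<in> carrier (term_lattice E I L)" if "x \<in> carrier (L i)" for x
    using that assms(1) by (auto simp: term_lattice_def intro!: imageI)
  then show "\<And>x. x \<in> carrier (L i) \<Longrightarrow> tclass E I L (LVar x) \<in> carrier (term_lattice E I L)" .
  fix x y assume xy: "x \<in> carrier (L i)" "y \<in> carrier (L i)"
  show "tclass E I L (LVar (x \<squnion>\<^bsub>L i\<^esub> y)) =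
      tclass E I L (LVar x) \<squnion>\<^bsub>term_lattice E I L\<^esub> tclass E I L (LVar y) \<and>
    tclass E I L (LVar (x \<sqinter>\<^bsub>L i\<^esub> y)) =
      tclass E I L (LVar x) \<sqinter>\<^bsub>term_lattice E I L\<^esub> tclass E I L (LVar y)"
    using term_lattice(2,3)[OF car[OF xy(1)] car[OF xy(2)]] assms(1) xy
    by (simp add: tclass_eq_iff tcong.sym tcong.join_rel tcong.meet_rel)
qed (rule term_lattice(1))

lemma term_lattice_universal:
  fixes L :: "'i \<Rightarrow> 'a gorder"
  assumes L: "\<forall>i\<in>I. is_lattice (L i)"
    and disj: "disjoint_except_for I L K"
  shows "universal_into TYPE('n) E I L K (term_lattice E I L) (\<lambda>i x. tclass E I L (LVar x))"
  unfolding universal_into_def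
proof (intro allI impI conjI ballI; (elim conjE)?)
  fix N :: "'n gorder" and g
  assume N: "in_variety E N" and g: "\<forall>i\<in>I. lattice_hom (L i) N (g i)"
    and ag: "agree_on I (carrier K) g"
  let ?T = "term_lattice E I L" and ?A = "\<Union>i\<in>I. carrier (L i)"
  have lat: "lattice N" using N by (simp add: in_variety_def is_lattice_def)
  obtain c where c: "c \<in> carrier N" using N by (auto simp: in_variety_def is_lattice_def)
  define v where "v x = (if x \<in> ?A then g (SOME i. i \<in> I \<and> x \<in> carrier (L i)) x else c)" for x
  have v: "v x = g i x" if i: "i \<in> I" "x \<in> carrier (L i)" for i x
  proof -
    let ?k = "SOME i. i \<in> I \<and> x \<in> carrier (L i)"
    have k: "?k \<in> I \<and> x \<in> carrier (L ?k)" by (rule someI) (use i in blast)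
    have "g ?k x = g i x"
    proof (cases "?k = i")
      case False
      then have "x \<in> carrier K" using disj k i unfolding disjoint_except_for_def by blast
      then show ?thesis using ag k i unfolding agree_on_def by blast
    qed simp
    then show ?thesis using i by (auto simp: v_def)
  qed
  have rv: "range v \<subseteq> carrier N"
  proof
    fix y assume "y \<in> range v"
    then obtain x where y: "y = v x" by blast
    show "y \<in> carrier N"
    proof (cases "x \<in> ?A")
      case True
      then obtain i where "i \<in> I" "x \<in> carrier (L i)" by blast
      then show ?thesis using v y g lattice_homD(1) by metis
    next
      case False
      then show ?thesis using y c by (simp add: v_def)
    qed
  qed
  have hom: "v (x \<squnion>\<^bsub>L i\<^esub> y) = v x \<squnion>\<^bsub>N\<^esub> v y \<and> v (x \<sqinter>\<^bsub>L i\<^esub> y) = v x \<sqinter>\<^bsub>N\<^esub> v y"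
    if i: "i \<in> I" "x \<in> carrier (L i)" "y \<in> carrier (L i)" for i x y
  proof -
    have "lattice (L i)" using L[rule_format, OF i(1)] by (simp add: is_lattice_def)
    note cl = lattice_laws(1,2)[OF this i(2,3)]
    show ?thesis
      using lattice_homD(2,3)[OF bspec[OF g i(1)] i(2,3)] v[OF i(1)] cl i by simp
  qed
  note sound = tcong_sound[OF N rv hom]
  define h where "h X = leval N v (SOME t. t \<in> X)" for X
  have h: "h (tclass E I L t) = leval N v t" for t
  proof -
    have "(SOME s. s \<in> tclass E I L t) \<in> tclass E I L t"
      by (rule someI[of _ t]) (simp add: tclass_def tcong.refl)
    then have "tcong E I L t (SOME s. s \<in> tclass E I L t)" by (simp add: tclass_def)
    from sound[OF _ _ _ this] show ?thesis by (simp add: h_def)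
  qed
  have "lattice_hom ?T N h"
  proof (rule lattice_homI[OF term_lattice(1) lat])
    show "h X \<in> carrier N" if "X \<in> carrier ?T" for X
      unfolding h_def by (rule leval_closed[OF lat rv])
    show "h (X \<squnion>\<^bsub>?T\<^esub> Y) = h X \<squnion>\<^bsub>N\<^esub> h Y \<and> h (X \<sqinter>\<^bsub>?T\<^esub> Y) = h X \<sqinter>\<^bsub>N\<^esub> h Y"
      if XY: "X \<in> carrier ?T" "Y \<in> carrier ?T" for X Y
    proof -
      obtain s t where "X = tclass E I L s" "Y = tclass E I L t"
        using XY by (auto simp: term_lattice_def)
      then show ?thesis using term_lattice(2,3)[OF XY] by (simp add: h)
    qed
  qed
  moreover have "\<forall>i\<in>I. \<forall>x\<in>carrier (L i). h (tclass E I L (LVar x)) = g i x"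
    using v by (simp add: h)
  ultimately show "\<exists>h. lattice_hom ?T N h \<and>
      (\<forall>i\<in>I. \<forall>x\<in>carrier (L i). h (tclass E I L (LVar x)) = g i x)"
    by blast
next
  fix N :: "'n gorder" and g h h' X
  let ?T = "term_lattice E I L" and ?A = "\<Union>i\<in>I. carrier (L i)"
  assume h: "lattice_hom ?T N h" "\<forall>i\<in>I. \<forall>x\<in>carrier (L i). h (tclass E I L (LVar x)) = g i x"
    and h': "lattice_hom ?T N h'" "\<forall>i\<in>I. \<forall>x\<in>carrier (L i). h' (tclass E I L (LVar x)) = g i x"
    and X: "X \<in> carrier ?T"
  have car: "tclass E I L t \<in> carrier ?T" if "set_lterm t \<subseteq> ?A" for t
    using that by (auto simp: term_lattice_def intro!: imageI)
  have "h (tclass E I L t) = h' (tclass E I L t)" if "set_lterm t \<subseteq> ?A" for t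
    using that
  proof (induction t)
    case (LVar x)
    then show ?case using h(2) h'(2) by auto
  next
    case (LJoin s t)
    then have c: "tclass E I L s \<in> carrier ?T" "tclass E I L t \<in> carrier ?T" using car by auto
    show ?case
      using lattice_homD(2)[OF h(1) c] lattice_homD(2)[OF h'(1) c] term_lattice(2)[OF c] LJoin by simp
  next
    case (LMeet s t)
    then have c: "tclass E I L s \<in> carrier ?T" "tclass E I L t \<in> carrier ?T" using car by auto
    show ?case
      using lattice_homD(3)[OF h(1) c] lattice_homD(3)[OF h'(1) c] term_lattice(3)[OF c] LMeet by simp
  qed
  then show "h X = h' X" using X by (auto simp: term_lattice_def)
qed

lemma universal_into_extend:
  assumes "universal_into TYPE('n) E I L K F \<eta>"
    and "in_variety E (N :: 'n gorder)" "\<forall>i\<in>I. lattice_hom (L i) N (g i)"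
    and "agree_on I (carrier K) g"
  obtains h where "lattice_hom F N h" "\<forall>i\<in>I. \<forall>x\<in>carrier (L i). h (\<eta> i x) = g i x"
  using assms(1)[unfolded universal_into_def, rule_format, of N g] assms(2-4) by blast

lemma universal_into_unique:
  assumes "universal_into TYPE('n) E I L K F \<eta>"
    and "in_variety E (N :: 'n gorder)" "\<forall>i\<in>I. lattice_hom (L i) N (g i)"
    and "agree_on I (carrier K) g"
    and "lattice_hom F N h" "\<forall>i\<in>I. \<forall>x\<in>carrier (L i). h (\<eta> i x) = g i x"
    and "lattice_hom F N h'" "\<forall>i\<in>I. \<forall>x\<in>carrier (L i). h' (\<eta> i x) = g i x"
    and "x \<in> carrier F"
  shows "h x = h' x"
  using assms(1)[unfolded universal_into_def, rule_format, of N g] assms(2-) by blast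

theorem free_amalgam_exists:
  fixes L :: "'i \<Rightarrow> 'a gorder"
  assumes I: "I \<noteq> {}" and L: "\<forall>i\<in>I. is_lattice (L i)" and disj: "disjoint_except_for I L K"
  shows "free_amalgam E I L K (term_lattice E I L) (\<lambda>i x. tclass E I L (LVar x))"
  unfolding free_amalgam_def
proof (intro conjI ballI)
  show "lattice_hom (L i) (term_lattice E I L) (\<lambda>x. tclass E I L (LVar x))" if "i \<in> I" for i
    using term_lattice_hom[OF that] L that by blast
qed (use term_lattice_in_variety[OF I L] term_lattice_universal[OF L disj] in
    \<open>simp_all add: agree_on_def\<close>)

theorem free_amalgam_universal:
  fixes L :: "'i \<Rightarrow> 'a gorder" and F :: "'l gorder"
  assumes I: "I \<noteq> {}" and L: "\<forall>i\<in>I. is_lattice (L i)"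
    and disj: "disjoint_except_for I L K"
    and F: "free_amalgam E I L K F \<eta>"
  shows "universal_into TYPE('n) E I L K F \<eta>"
proof -
  let ?T = "term_lattice E I L" and ?\<tau> = "\<lambda>(i::'i) x. tclass E I L (LVar x)"
  have F: "in_variety E F" "\<forall>i\<in>I. lattice_hom (L i) F (\<eta> i)" "agree_on I (carrier K) \<eta>"
    "universal_into TYPE('l) E I L K F \<eta>" "universal_into TYPE('a lterm set) E I L K F \<eta>"
    using F by (auto simp: free_amalgam_def)
  have T: "in_variety E ?T" "\<forall>i\<in>I. lattice_hom (L i) ?T (?\<tau> i)" "agree_on I (carrier K) ?\<tau>"
    using free_amalgam_exists[OF I L disj, of E] by (auto simp: free_amalgam_def)
  obtain h where h: "lattice_hom F ?T h"
    "\<forall>i\<in>I. \<forall>x\<in>carrier (L i). h (\<eta> i x) = tclass E I L (LVar x)"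
    by (rule universal_into_extend[OF F(5) T])
  obtain k where k: "lattice_hom ?T F k"
    "\<forall>i\<in>I. \<forall>x\<in>carrier (L i). k (tclass E I L (LVar x)) = \<eta> i x"
    by (rule universal_into_extend[OF term_lattice_universal[OF L disj] F(1-3)])
  have latF: "lattice F" using F(1) by (simp add: in_variety_def is_lattice_def)
  have kh: "k (h x) = x" if "x \<in> carrier F" for x
    by (rule universal_into_unique[OF F(4) F(1-3) lattice_hom_comp[OF h(1) k(1)]
          _ lattice_homI[OF latF latF, of "\<lambda>x. x"] _ that])
      (use h(2) k(2) in simp_all)
  show ?thesis
    unfolding universal_into_def
  proof (intro allI impI conjI ballI; (elim conjE)?)
    fix N :: "'n gorder" and g
    assume N: "in_variety E N" "\<forall>i\<in>I. lattice_hom (L i) N (g i)" "agree_on I (carrier K) g"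
    obtain p where p: "lattice_hom ?T N p"
      "\<forall>i\<in>I. \<forall>x\<in>carrier (L i). p (tclass E I L (LVar x)) = g i x"
      by (rule universal_into_extend[OF term_lattice_universal[OF L disj] N])
    show "\<exists>h. lattice_hom F N h \<and> (\<forall>i\<in>I. \<forall>x\<in>carrier (L i). h (\<eta> i x) = g i x)"
      using lattice_hom_comp[OF h(1) p(1)] h(2) p(2) by (intro exI[of _ "\<lambda>x. p (h x)"]) simp
  next
    fix N :: "'n gorder" and g p q x
    assume N: "in_variety E N" "\<forall>i\<in>I. lattice_hom (L i) N (g i)" "agree_on I (carrier K) g"
      and p: "lattice_hom F N p" "\<forall>i\<in>I. \<forall>x\<in>carrier (L i). p (\<eta> i x) = g i x"
      and q: "lattice_hom F N q" "\<forall>i\<in>I. \<forall>x\<in>carrier (L i). q (\<eta> i x) = g i x"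
      and x: "x \<in> carrier F"
    have "p (k (h x)) = q (k (h x))"
      by (rule universal_into_unique[OF term_lattice_universal[OF L disj] N
            lattice_hom_comp[OF k(1) p(1)] _ lattice_hom_comp[OF k(1) q(1)] _
            lattice_homD(1)[OF h(1) x x]])
        (use k(2) p(2) q(2) in simp_all)
    then show "p x = q x" using kh[OF x] by simp
  qed
qed

end

theory Submission
  imports Defs
begin

text \<open>The retractions yield homomorphisms \<open>p i\<close> from the free lattice onto each \<open>L i\<close>, the identity
  on \<open>L i\<close> and \<open>\<rho> j\<close> on the other \<open>L j\<close>. Let \<open>D i\<close> be the ideal of \<open>L i\<close> generated by \<open>K\<close>;
  convexity makes \<open>x \<le> \<rho> i x\<close> hold for all \<open>x\<close> in \<open>D i\<close>. Send \<open>X\<close> to the join of the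
  \<open>\<phi> i (p i X)\<close> over all \<open>i\<close> with \<open>p i X\<close> outside \<open>D i\<close>, and to the meet of all \<open>\<phi> i (p i X)\<close>
  if there is no such \<open>i\<close>. The index set of the join grows with \<open>X\<close>, so this map is isotone. Joins
  and meets are finite because an element of the free lattice involves only finitely many \<open>L i\<close>,
  and the remaining \<open>p i X\<close> are one and the same element of \<open>K\<close>.\<close>

section \<open>Order, homomorphisms and isotone maps\<close>

lemma lattice_partial_order: "lattice N \<Longrightarrow> partial_order N"
  using lattice.axioms(1) upper_semilattice.axioms(1) by blast

lemma lattice_weak_partial_order: "lattice N \<Longrightarrow> weak_partial_order N"
  using lattice_partial_order partial_order.axioms(1) by blast

lemma lattice_le_refl: "lattice N \<Longrightarrow> x \<in> carrier N \<Longrightarrow> x \<sqsubseteq>\<^bsub>N\<^esub> x"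
  by (rule weak_partial_order.le_refl[OF lattice_weak_partial_order])

lemma lattice_le_trans:
  "lattice N \<Longrightarrow> x \<sqsubseteq>\<^bsub>N\<^esub> y \<Longrightarrow> y \<sqsubseteq>\<^bsub>N\<^esub> z \<Longrightarrow>
    x \<in> carrier N \<Longrightarrow> y \<in> carrier N \<Longrightarrow> z \<in> carrier N \<Longrightarrow> x \<sqsubseteq>\<^bsub>N\<^esub> z"
  by (rule weak_partial_order.le_trans[OF lattice_weak_partial_order])

lemma lattice_le_antisym:
  "lattice N \<Longrightarrow> x \<sqsubseteq>\<^bsub>N\<^esub> y \<Longrightarrow> y \<sqsubseteq>\<^bsub>N\<^esub> x \<Longrightarrow>
    x \<in> carrier N \<Longrightarrow> y \<in> carrier N \<Longrightarrow> x = y"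
  by (rule partial_order.le_antisym[OF lattice_partial_order])

lemma lattice_hom_le:
  assumes "lattice_hom A B f" "x \<in> carrier A" "y \<in> carrier A" "x \<sqsubseteq>\<^bsub>A\<^esub> y"
  shows "f x \<sqsubseteq>\<^bsub>B\<^esub> f y"
proof -
  have lat: "lattice A" "lattice B" using lattice_hom_lattice[OF assms(1)] by auto
  \<comment> \<open>Despite its name, \<open>le_iff_meet\<close> expresses the order through joins:
    x \<le> y iff the join of x and y is y.\<close>
  have "x \<squnion>\<^bsub>A\<^esub> y = y" using lattice.le_iff_meet[OF lat(1)] assms by blast
  then have "f x \<squnion>\<^bsub>B\<^esub> f y = f y" using lattice_homD(2)[OF assms(1-3)] by simp
  then show ?thesis
    using lattice.le_iff_meet[OF lat(2)] lattice_homD(1)[OF assms(1)] assms(2,3) by blast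
qed

lemma isotone_mapI:
  assumes "lattice A" "lattice B" "\<And>x. x \<in> carrier A \<Longrightarrow> f x \<in> carrier B"
    "\<And>x y. x \<in> carrier A \<Longrightarrow> y \<in> carrier A \<Longrightarrow> x \<sqsubseteq>\<^bsub>A\<^esub> y \<Longrightarrow> f x \<sqsubseteq>\<^bsub>B\<^esub> f y"
  shows "isotone_map A B f"
  using assms lattice_weak_partial_order[of A] lattice_weak_partial_order[of B]
  by (auto simp: isotone_map_def isotone_def)

lemma isotone_mapD:
  assumes "isotone_map A B f" "x \<in> carrier A"
  shows "f x \<in> carrier B" "y \<in> carrier A \<Longrightarrow> x \<sqsubseteq>\<^bsub>A\<^esub> y \<Longrightarrow> f x \<sqsubseteq>\<^bsub>B\<^esub> f y"
  using assms by (auto simp: isotone_map_def isotone_def)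

lemma isotone_map_comp_hom:
  assumes f: "lattice_hom A B f" and g: "isotone_map B C g" and C: "lattice C"
  shows "isotone_map A C (\<lambda>x. g (f x))"
proof (rule isotone_mapI)
  show "lattice A" using lattice_hom_lattice[OF f] by blast
qed (use C lattice_homD(1)[OF f] lattice_hom_le[OF f] isotone_mapD[OF g] in auto)

section \<open>Joins and meets of finite nonempty sets\<close>

lemma finite_sup:
  assumes "lattice N" "finite A" "A \<subseteq> carrier N" "A \<noteq> {}"
  shows "\<Squnion>\<^bsub>N\<^esub>A \<in> carrier N" "a \<in> A \<Longrightarrow> a \<sqsubseteq>\<^bsub>N\<^esub> \<Squnion>\<^bsub>N\<^esub>A"
    "b \<in> carrier N \<Longrightarrow> (\<And>a. a \<in> A \<Longrightarrow> a \<sqsubseteq>\<^bsub>N\<^esub> b) \<Longrightarrow> \<Squnion>\<^bsub>N\<^esub>A \<sqsubseteq>\<^bsub>N\<^esub> b"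
proof -
  interpret lattice N by fact
  have l: "least N (\<Squnion>\<^bsub>N\<^esub>A) (Upper N A)" using finite_sup_least assms by blast
  then show "\<Squnion>\<^bsub>N\<^esub>A \<in> carrier N" by (rule least_closed)
  show "a \<sqsubseteq>\<^bsub>N\<^esub> \<Squnion>\<^bsub>N\<^esub>A" if "a \<in> A" using least_Upper_above[OF l that assms(3)] .
  show "\<Squnion>\<^bsub>N\<^esub>A \<sqsubseteq>\<^bsub>N\<^esub> b" if "b \<in> carrier N" "\<And>a. a \<in> A \<Longrightarrow> a \<sqsubseteq>\<^bsub>N\<^esub> b"
    using least_le[OF l] that assms(3) by (auto simp: Upper_def)
qed

lemma finite_inf:
  assumes "lattice N" "finite A" "A \<subseteq> carrier N" "A \<noteq> {}"
  shows "\<Sqinter>\<^bsub>N\<^esub>A \<in> carrier N" "a \<in> A \<Longrightarrow> \<Sqinter>\<^bsub>N\<^esub>A \<sqsubseteq>\<^bsub>N\<^esub> a"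
    "b \<in> carrier N \<Longrightarrow> (\<And>a. a \<in> A \<Longrightarrow> b \<sqsubseteq>\<^bsub>N\<^esub> a) \<Longrightarrow> b \<sqsubseteq>\<^bsub>N\<^esub> \<Sqinter>\<^bsub>N\<^esub>A"
proof -
  interpret lattice N by fact
  have l: "greatest N (\<Sqinter>\<^bsub>N\<^esub>A) (Lower N A)" using finite_inf_greatest assms by blast
  then show "\<Sqinter>\<^bsub>N\<^esub>A \<in> carrier N" by (rule greatest_closed)
  show "\<Sqinter>\<^bsub>N\<^esub>A \<sqsubseteq>\<^bsub>N\<^esub> a" if "a \<in> A" using greatest_Lower_below[OF l that assms(3)] .
  show "b \<sqsubseteq>\<^bsub>N\<^esub> \<Sqinter>\<^bsub>N\<^esub>A" if "b \<in> carrier N" "\<And>a. a \<in> A \<Longrightarrow> b \<sqsubseteq>\<^bsub>N\<^esub> a"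
    using greatest_le[OF l] that assms(3) by (auto simp: Lower_def)
qed

section \<open>Sublattices and retractions\<close>

lemma sublatticeD:
  assumes "sublattice K N"
  shows "lattice K" "lattice N" "x \<in> carrier K \<Longrightarrow> x \<in> carrier N"
    and "x \<in> carrier K \<Longrightarrow> y \<in> carrier K \<Longrightarrow> x \<squnion>\<^bsub>N\<^esub> y = x \<squnion>\<^bsub>K\<^esub> y"
    and "x \<in> carrier K \<Longrightarrow> y \<in> carrier K \<Longrightarrow> x \<sqinter>\<^bsub>N\<^esub> y = x \<sqinter>\<^bsub>K\<^esub> y"
    and "x \<in> carrier K \<Longrightarrow> y \<in> carrier K \<Longrightarrow> x \<sqsubseteq>\<^bsub>N\<^esub> y \<longleftrightarrow> x \<sqsubseteq>\<^bsub>K\<^esub> y"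
  using assms by (auto simp: sublattice_def is_lattice_def)

text \<open>Composition with the inclusion of \<open>K\<close>. It turns a retraction of one
  \<open>L j\<close> into a homomorphism to another \<open>L i\<close>.\<close>

lemma lattice_hom_sublattice:
  assumes f: "lattice_hom A K f" and K: "sublattice K N"
  shows "lattice_hom A N f"
proof (rule lattice_homI)
  show "lattice A" using lattice_hom_lattice[OF f] by blast
qed (use sublatticeD[OF K] lattice_homD[OF f] in auto)

text \<open>From \<open>x\<close> \<le> \<open>k\<close> follows \<open>r x\<close> \<le>
  \<open>r k\<close> = \<open>k\<close>, so the join of \<open>x\<close> and \<open>r x\<close> lies
  between \<open>r x\<close> and \<open>k\<close>. Convexity puts this join in \<open>K\<close>,
  where \<open>r\<close> fixes it; but \<open>r\<close> also sends it to the join of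
  \<open>r x\<close> with itself. Hence it equals \<open>r x\<close>.\<close>

lemma retraction_above:
  assumes sub: "sublattice K N" and conv: "convex_in K N" and r: "lattice_retraction N K r"
    and x: "x \<in> carrier N" and k: "k \<in> carrier K" "x \<sqsubseteq>\<^bsub>N\<^esub> k"
  shows "x \<sqsubseteq>\<^bsub>N\<^esub> r x"
proof -
  note D = sublatticeD[OF sub]
  interpret N: lattice N by (rule D(2))
  have hom: "lattice_hom N K r" and id: "\<And>y. y \<in> carrier K \<Longrightarrow> r y = y"
    using r by (auto simp: lattice_retraction_def)
  have rx: "r x \<in> carrier K" using lattice_homD(1)[OF hom x x] .
  have kN: "k \<in> carrier N" using D(3) k by blast
  have rxN: "r x \<in> carrier N" using D(3) rx by blast
  have "r x \<sqsubseteq>\<^bsub>K\<^esub> r k" by (rule lattice_hom_le[OF hom x kN k(2)])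
  then have "r x \<sqsubseteq>\<^bsub>N\<^esub> k" using id D(6) rx k by simp
  then have "x \<squnion>\<^bsub>N\<^esub> r x \<sqsubseteq>\<^bsub>N\<^esub> k" by (rule N.join_le[OF k(2) _ x rxN kN])
  moreover have "r x \<sqsubseteq>\<^bsub>N\<^esub> x \<squnion>\<^bsub>N\<^esub> r x" by (rule N.join_right[OF x rxN])
  ultimately have "x \<squnion>\<^bsub>N\<^esub> r x \<in> carrier K"
    using conv rx k(1) N.join_closed[OF x rxN] unfolding convex_in_def by blast
  then have "x \<squnion>\<^bsub>N\<^esub> r x = r (x \<squnion>\<^bsub>N\<^esub> r x)" by (simp add: id)
  also have "\<dots> = r x \<squnion>\<^bsub>K\<^esub> r x" using lattice_homD(2)[OF hom x rxN] id[OF rx] by simp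
  also have "\<dots> = r x"
    using lattice.le_iff_meet[OF D(1) rx rx] lattice_le_refl[OF D(1) rx] by simp
  finally show ?thesis using N.le_iff_meet[OF x rxN] by simp
qed

section \<open>Joins over an index set, with a substitute for the empty join\<close>

text \<open>A join over empty \<open>B\<close> may fail to exist, because \<open>M\<close> may have
  no least element. The meet over all of \<open>I\<close> replaces it: it lies below every
  \<open>f i\<close>, hence below the join over any nonempty \<open>B\<close> inside
  \<open>I\<close>.\<close>

definition join_or_meet :: "'m gorder \<Rightarrow> 'i set \<Rightarrow> 'i set \<Rightarrow> ('i \<Rightarrow> 'm) \<Rightarrow> 'm" where
  "join_or_meet M I B f = (if B = {} then \<Sqinter>\<^bsub>M\<^esub>(f ` I) else \<Squnion>\<^bsub>M\<^esub>(f ` B))"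

lemma join_or_meet_closed:
  assumes "lattice M" "I \<noteq> {}" "B \<subseteq> I" "f ` I \<subseteq> carrier M" "finite (f ` I)"
  shows "join_or_meet M I B f \<in> carrier M"
proof -
  have "finite (f ` B)" "f ` B \<subseteq> carrier M"
    using assms(3-5) finite_subset[of "f ` B" "f ` I"] by blast+
  then show ?thesis
    using finite_inf(1)[OF assms(1,5,4)] finite_sup(1)[OF assms(1), of "f ` B"] assms(2)
    by (auto simp: join_or_meet_def)
qed

text \<open>If both index sets are empty, two meets over the same \<open>I\<close> are compared. If
  only \<open>B\<close> is empty, any \<open>i\<close> in \<open>C\<close> links the two sides: the
  meet lies below \<open>f i\<close>, then \<open>g i\<close>, then the join. Otherwise each
  \<open>f i\<close> with \<open>i\<close> in \<open>B\<close> lies below \<open>g i\<close>, a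
  member of the larger join. Finiteness is asked of the images, since \<open>I\<close> itself may be
  infinite.\<close>

lemma join_or_meet_mono:
  assumes M: "lattice M" and I: "I \<noteq> {}" and BC: "B \<subseteq> C" and CI: "C \<subseteq> I"
    and f: "f ` I \<subseteq> carrier M" "finite (f ` I)" and g: "g ` I \<subseteq> carrier M" "finite (g ` I)"
    and le: "\<And>i. i \<in> I \<Longrightarrow> f i \<sqsubseteq>\<^bsub>M\<^esub> g i"
  shows "join_or_meet M I B f \<sqsubseteq>\<^bsub>M\<^esub> join_or_meet M I C g"
proof -
  have fB: "finite (f ` B)" "f ` B \<subseteq> carrier M"
    using f BC CI finite_subset[of "f ` B" "f ` I"] by blast+
  have gC: "finite (g ` C)" "g ` C \<subseteq> carrier M"
    using g CI finite_subset[of "g ` C" "g ` I"] by blast+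
  have fI: "f ` I \<noteq> {}" and gI: "g ` I \<noteq> {}" using I by auto
  note inff = finite_inf[OF M f(2,1) fI] and infg = finite_inf[OF M g(2,1) gI]
  have fc: "f i \<in> carrier M" and gc: "g i \<in> carrier M" if "i \<in> I" for i using f(1) g(1) that by blast+
  have sup_closed: "\<Squnion>\<^bsub>M\<^esub>(g ` C) \<in> carrier M" if "C \<noteq> {}"
    using finite_sup(1)[OF M gC] that by simp
  have inf_le: "\<Sqinter>\<^bsub>M\<^esub>(f ` I) \<sqsubseteq>\<^bsub>M\<^esub> g i" if i: "i \<in> I" for i
    using lattice_le_trans[OF M inff(2)[OF imageI[OF i]] le[OF i] inff(1) fc[OF i] gc[OF i]] .
  have le_sup: "f i \<sqsubseteq>\<^bsub>M\<^esub> \<Squnion>\<^bsub>M\<^esub>(g ` C)" if i: "i \<in> C" for i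
  proof -
    have iI: "i \<in> I" and C: "C \<noteq> {}" "g ` C \<noteq> {}" using i CI by auto
    show ?thesis
      using lattice_le_trans[OF M le[OF iI] finite_sup(2)[OF M gC C(2) imageI[OF i]]
          fc[OF iI] gc[OF iI] sup_closed[OF C(1)]] .
  qed
  consider "C = {}" "B = {}" | i where "i \<in> C" "B = {}" | "B \<noteq> {}" "C \<noteq> {}" using BC by blast
  then show ?thesis
  proof cases
    case 1
    then show ?thesis using infg(3)[OF inff(1)] inf_le by (auto simp: join_or_meet_def)
  next
    case 2
    then have iI: "i \<in> I" and C: "C \<noteq> {}" using CI by auto
    have "\<Sqinter>\<^bsub>M\<^esub>(f ` I) \<sqsubseteq>\<^bsub>M\<^esub> \<Squnion>\<^bsub>M\<^esub>(g ` C)"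
      using lattice_le_trans[OF M inff(2)[OF imageI[OF iI]] le_sup[OF 2(1)] inff(1) fc[OF iI]
          sup_closed[OF C]] .
    then show ?thesis using 2(2) C by (simp add: join_or_meet_def)
  next
    case 3
    then show ?thesis
      using finite_sup(3)[OF M fB _ sup_closed] le_sup BC
      by (auto simp: join_or_meet_def)
  qed
qed

section \<open>Projections of the term lattice onto the \<open>L i\<close>\<close>

text \<open>Take the identity on \<open>L i\<close> and \<open>\<rho> j\<close> on every other
  \<open>L j\<close>, its values in \<open>K\<close> read as elements of \<open>L i\<close>. All
  these homomorphisms are the identity on \<open>K\<close>, so they agree there; \<open>L i\<close>
  is in the variety, and universality supplies \<open>p\<close>.\<close>

lemma term_lattice_projection:
  fixes L :: "'i \<Rightarrow> 'a gorder"
  assumes sub: "\<forall>i\<in>I. sublattice K (L i)"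
    and disj: "disjoint_except_for I L K"
    and retr: "\<forall>i\<in>I. lattice_retraction (L i) K (\<rho> i)"
    and V: "in_variety V (L i)" and i: "i \<in> I"
  shows "\<exists>p. lattice_hom (term_lattice V I L) (L i) p \<and>
    (\<forall>j\<in>I. \<forall>x\<in>carrier (L j). p (tclass V I L (LVar x)) = (if j = i then x else \<rho> j x))"
proof -
  let ?g = "\<lambda>j x. if j = i then x else \<rho> j x"
  have is_lat: "\<forall>i\<in>I. is_lattice (L i)" using sub by (simp add: sublattice_def)
  have "lattice_hom (L j) (L i) (?g j)" if j: "j \<in> I" for j
  proof (cases "j = i")
    case True
    have "lattice (L i)" using is_lat i by (simp add: is_lattice_def)
    then show ?thesis using True by (auto intro: lattice_homI)
  next
    case False
    then show ?thesis
      using lattice_hom_sublattice[of "L j" K "\<rho> j" "L i"] retr sub i j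
      by (simp add: lattice_retraction_def)
  qed
  then have hom: "\<forall>j\<in>I. lattice_hom (L j) (L i) (?g j)" by blast
  have ag: "agree_on I (carrier K) ?g" using retr by (simp add: agree_on_def lattice_retraction_def)
  show ?thesis
    by (rule universal_into_extend[OF term_lattice_universal[OF is_lat disj] V hom ag]) blast
qed

text \<open>Induction on a term representing \<open>X\<close>. At a variable \<open>x\<close> from
  \<open>L j\<close>, every projection but the \<open>j\<close>-th takes the value
  \<open>\<rho> j x\<close>. At a join or meet the exceptional sets unite and the two constants
  combine inside \<open>K\<close>, whose operations agree with those of every \<open>L i\<close>; so
  the new constant is again independent of \<open>i\<close>.\<close>

lemma term_lattice_projections_finite:
  fixes L :: "'i \<Rightarrow> 'a gorder"
  assumes I: "I \<noteq> {}" and sub: "\<forall>i\<in>I. sublattice K (L i)"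
    and retr: "\<forall>i\<in>I. lattice_retraction (L i) K (\<rho> i)"
    and proj: "\<forall>i\<in>I. lattice_hom (term_lattice V I L) (L i) (p i) \<and>
      (\<forall>j\<in>I. \<forall>x\<in>carrier (L j). p i (tclass V I L (LVar x)) = (if j = i then x else \<rho> j x))"
    and X: "X \<in> carrier (term_lattice V I L)"
  shows "\<exists>J c. finite J \<and> c \<in> carrier K \<and> (\<forall>i\<in>I - J. p i X = c)"
proof -
  let ?T = "term_lattice V I L" and ?A = "\<Union>i\<in>I. carrier (L i)"
  have p: "\<And>i. i \<in> I \<Longrightarrow> lattice_hom ?T (L i) (p i)"
    and p_var: "\<And>i j x. i \<in> I \<Longrightarrow> j \<in> I \<Longrightarrow> x \<in> carrier (L j) \<Longrightarrow>
      p i (tclass V I L (LVar x)) = (if j = i then x else \<rho> j x)"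
    using proj by simp_all
  let ?P = "\<lambda>X. \<exists>J c. finite J \<and> c \<in> carrier K \<and> (\<forall>i\<in>I - J. p i X = c)"
  have car: "tclass V I L t \<in> carrier ?T" if "set_lterm t \<subseteq> ?A" for t
    using that by (auto simp: term_lattice_def intro!: imageI)
  have K: "lattice K" using I sub sublatticeD(1) by blast
  obtain t where t: "set_lterm t \<subseteq> ?A" "X = tclass V I L t"
    using X by (auto simp: term_lattice_def)
  have "?P (tclass V I L t)" using t(1)
  proof (induction t)
    case (LVar x)
    then obtain j where j: "j \<in> I" "x \<in> carrier (L j)" by auto
    have "\<rho> j x \<in> carrier K"
      using lattice_homD(1) retr j unfolding lattice_retraction_def by metis
    then show ?case using p_var j by (intro exI[of _ "{j}"] exI[of _ "\<rho> j x"]) auto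
  next
    case (LJoin s t)
    then obtain J c J' c' where c: "finite J" "c \<in> carrier K" "\<forall>i\<in>I - J. p i (tclass V I L s) = c"
      "finite J'" "c' \<in> carrier K" "\<forall>i\<in>I - J'. p i (tclass V I L t) = c'" by auto
    have st: "tclass V I L s \<in> carrier ?T" "tclass V I L t \<in> carrier ?T"
      using LJoin.prems car by auto
    have "p i (tclass V I L (LJoin s t)) = c \<squnion>\<^bsub>K\<^esub> c'" if i: "i \<in> I - (J \<union> J')" for i
      using lattice_homD(2)[OF p st] term_lattice(2)[OF st] c i
        sublatticeD(4)[OF sub[rule_format], of i c c'] by simp
    then show ?case
      using c lattice_laws(1)[OF K c(2,5)]
      by (intro exI[of _ "J \<union> J'"] exI[of _ "c \<squnion>\<^bsub>K\<^esub> c'"]) simp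
  next
    case (LMeet s t)
    then obtain J c J' c' where c: "finite J" "c \<in> carrier K" "\<forall>i\<in>I - J. p i (tclass V I L s) = c"
      "finite J'" "c' \<in> carrier K" "\<forall>i\<in>I - J'. p i (tclass V I L t) = c'" by auto
    have st: "tclass V I L s \<in> carrier ?T" "tclass V I L t \<in> carrier ?T"
      using LMeet.prems car by auto
    have "p i (tclass V I L (LMeet s t)) = c \<sqinter>\<^bsub>K\<^esub> c'" if i: "i \<in> I - (J \<union> J')" for i
      using lattice_homD(3)[OF p st] term_lattice(3)[OF st] c i
        sublatticeD(5)[OF sub[rule_format], of i c c'] by simp
    then show ?case
      using c lattice_laws(2)[OF K c(2,5)]
      by (intro exI[of _ "J \<union> J'"] exI[of _ "c \<sqinter>\<^bsub>K\<^esub> c'"]) simp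
  qed
  then show ?thesis using t by simp
qed

section \<open>The isotone extension on the term lattice\<close>

text \<open>The map is built on this concrete model because the finiteness of its joins and meets
  rests on induction on terms.\<close>

lemma term_lattice_isotone_extension:
  fixes L :: "'i \<Rightarrow> 'a gorder" and M :: "'m gorder"
  assumes I: "I \<noteq> {}" and sub: "\<forall>i\<in>I. sublattice K (L i)"
    and disj: "disjoint_except_for I L K"
    and conv: "\<forall>i\<in>I. convex_in K (L i)"
    and retr: "\<forall>i\<in>I. lattice_retraction (L i) K (\<rho> i)"
    and V: "\<forall>i\<in>I. in_variety V (L i)"
    and M: "lattice M"
    and \<phi>: "\<forall>i\<in>I. isotone_map (L i) M (\<phi> i)" and ag: "agree_on I (carrier K) \<phi>"
  obtains \<psi> where "isotone_map (term_lattice V I L) M \<psi>"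
    and "\<forall>i\<in>I. \<forall>x\<in>carrier (L i). \<psi> (tclass V I L (LVar x)) = \<phi> i x"
proof -
  let ?T = "term_lattice V I L"
  have "\<forall>i\<in>I. \<exists>p. lattice_hom ?T (L i) p \<and>
      (\<forall>j\<in>I. \<forall>x\<in>carrier (L j). p (tclass V I L (LVar x)) = (if j = i then x else \<rho> j x))"
    using term_lattice_projection[OF sub disj retr] V by (intro ballI) simp
  from bchoice[OF this] obtain p where proj: "\<forall>i\<in>I. lattice_hom ?T (L i) (p i) \<and>
      (\<forall>j\<in>I. \<forall>x\<in>carrier (L j). p i (tclass V I L (LVar x)) = (if j = i then x else \<rho> j x))" ..
  have p: "\<And>i. i \<in> I \<Longrightarrow> lattice_hom ?T (L i) (p i)"
    and p_var: "\<And>i j x. i \<in> I \<Longrightarrow> j \<in> I \<Longrightarrow> x \<in> carrier (L j) \<Longrightarrow>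
      p i (tclass V I L (LVar x)) = (if j = i then x else \<rho> j x)"
    using proj by simp_all
  have pc: "p i X \<in> carrier (L i)" if "i \<in> I" "X \<in> carrier ?T" for i X
    using lattice_homD(1)[OF p[OF that(1)] that(2,2)] .
  have lat: "lattice (L i)" and KL: "carrier K \<subseteq> carrier (L i)" if "i \<in> I" for i
    using sublatticeD(2,3)[OF sub[rule_format, OF that]] by auto
  have \<phi>_eq: "\<phi> i k = \<phi> j k" if "i \<in> I" "j \<in> I" "k \<in> carrier K" for i j k
    using ag that unfolding agree_on_def by blast
  define D where "D i = {x \<in> carrier (L i). \<exists>k\<in>carrier K. x \<sqsubseteq>\<^bsub>L i\<^esub> k}" for i
  define B where "B X = {i \<in> I. p i X \<notin> D i}" for X
  define \<psi> where "\<psi> X = join_or_meet M I (B X) (\<lambda>i. \<phi> i (p i X))" for X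
  have cl: "\<phi> i (p i X) \<in> carrier M" if "i \<in> I" "X \<in> carrier ?T" for i X
    using isotone_mapD(1)[OF \<phi>[rule_format, OF that(1)] pc[OF that]] .
  have fin: "finite ((\<lambda>i. \<phi> i (p i X)) ` I)" if X: "X \<in> carrier ?T" for X
  proof -
    from term_lattice_projections_finite[OF I sub retr proj X]
    obtain J c where J: "finite J" "c \<in> carrier K" "\<forall>i\<in>I - J. p i X = c" by (elim exE conjE)
    obtain i0 where i0: "i0 \<in> I" using I by blast
    \<comment> \<open>Outside \<open>J\<close> every value is \<open>\<phi> i c\<close> with
      \<open>c\<close> in \<open>K\<close>. The maps agree on \<open>K\<close>, so an arbitrary
      index \<open>i0\<close> names this common value.\<close>
    have "(\<lambda>i. \<phi> i (p i X)) ` I \<subseteq> insert (\<phi> i0 c) ((\<lambda>i. \<phi> i (p i X)) ` J)"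
    proof (rule image_subsetI)
      fix i assume i: "i \<in> I"
      show "\<phi> i (p i X) \<in> insert (\<phi> i0 c) ((\<lambda>i. \<phi> i (p i X)) ` J)"
      proof (cases "i \<in> J")
        case False
        then have "p i X = c" using J(3) i by simp
        then have "\<phi> i (p i X) = \<phi> i0 c" using \<phi>_eq[OF i i0 J(2)] by simp
        then show ?thesis by simp
      qed simp
    qed
    then show ?thesis using J(1) finite_subset by blast
  qed
  \<comment> \<open>\<open>D i\<close> is a down-set and \<open>p i\<close> preserves order: if
    \<open>p i Y\<close> is bounded by an element of \<open>K\<close>, so is
    \<open>p i X\<close>.\<close>
  have B_mono: "B X \<subseteq> B Y" if XY: "X \<in> carrier ?T" "Y \<in> carrier ?T" "X \<sqsubseteq>\<^bsub>?T\<^esub> Y" for X Y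
  proof
    fix i assume "i \<in> B X"
    then have i: "i \<in> I" "p i X \<notin> D i" by (auto simp: B_def)
    have "p i Y \<notin> D i"
    proof
      assume "p i Y \<in> D i"
      then obtain k where k: "k \<in> carrier K" "p i Y \<sqsubseteq>\<^bsub>L i\<^esub> k" by (auto simp: D_def)
      have "p i X \<sqsubseteq>\<^bsub>L i\<^esub> k"
        using lattice_le_trans[OF lat[OF i(1)] lattice_hom_le[OF p[OF i(1)] XY] k(2)
          pc[OF i(1) XY(1)] pc[OF i(1) XY(2)] subsetD[OF KL[OF i(1)] k(1)]] .
      then show False using i(2) k(1) pc[OF i(1) XY(1)] by (auto simp: D_def)
    qed
    then show "i \<in> B Y" using i by (simp add: B_def)
  qed
  have "isotone_map ?T M \<psi>"
  proof (rule isotone_mapI[OF term_lattice(1) M])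
    show "\<psi> X \<in> carrier M" if "X \<in> carrier ?T" for X
      unfolding \<psi>_def by (rule join_or_meet_closed[OF M I]) (use that cl fin in \<open>auto simp: B_def\<close>)
    show "\<psi> X \<sqsubseteq>\<^bsub>M\<^esub> \<psi> Y" if XY: "X \<in> carrier ?T" "Y \<in> carrier ?T" "X \<sqsubseteq>\<^bsub>?T\<^esub> Y" for X Y
      unfolding \<psi>_def
    proof (rule join_or_meet_mono[OF M I B_mono[OF XY]])
      show "\<phi> i (p i X) \<sqsubseteq>\<^bsub>M\<^esub> \<phi> i (p i Y)" if "i \<in> I" for i
        using isotone_mapD(2)[OF \<phi>[rule_format, OF that] pc[OF that XY(1)] pc[OF that XY(2)]
          lattice_hom_le[OF p[OF that] XY]] .
    qed (use XY cl fin in \<open>auto simp: B_def\<close>)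
  qed
  moreover have "\<psi> (tclass V I L (LVar x)) = \<phi> j x" if j: "j \<in> I" "x \<in> carrier (L j)" for j x
  proof -
    let ?X = "tclass V I L (LVar x)"
    have X: "?X \<in> carrier ?T" using j by (auto simp: term_lattice_def intro!: imageI)
    have r: "\<rho> j x \<in> carrier K"
      using lattice_homD(1) retr j unfolding lattice_retraction_def by metis
    \<comment> \<open>\<open>D i\<close> contains \<open>K\<close>, so at a generator from
      \<open>L j\<close> only the index \<open>j\<close> can enter the join.\<close>
    have "\<rho> j x \<in> D i" if "i \<in> I" for i
      using r subsetD[OF KL[OF that] r] lattice_le_refl[OF lat[OF that]] by (auto simp: D_def)
    then have off: "p i ?X \<in> D i" if "i \<in> I" "i \<noteq> j" for i
      using p_var[OF that(1) j] that by simp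
    have on: "p j ?X = x" using p_var[OF j(1) j] by simp
    have \<phi>x: "\<phi> j x \<in> carrier M" using isotone_mapD(1)[OF bspec[OF \<phi> j(1)] j(2)] .
    show ?thesis
    proof (cases "x \<in> D j")
      case False
      then have "B ?X = {j}" using off on j by (auto simp: B_def)
      then have \<psi>: "\<psi> ?X = \<Squnion>\<^bsub>M\<^esub>{\<phi> j x}" using on by (simp add: \<psi>_def join_or_meet_def)
      have single: "finite {\<phi> j x}" "{\<phi> j x} \<subseteq> carrier M" "{\<phi> j x} \<noteq> {}" using \<phi>x by auto
      note sup = finite_sup[OF M single]
      have "\<Squnion>\<^bsub>M\<^esub>{\<phi> j x} = \<phi> j x"
      proof (rule lattice_le_antisym[OF M sup(3)[OF \<phi>x] sup(2) sup(1) \<phi>x])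
        show "a \<sqsubseteq>\<^bsub>M\<^esub> \<phi> j x" if "a \<in> {\<phi> j x}" for a using that lattice_le_refl[OF M \<phi>x] by simp
      qed simp
      then show ?thesis using \<psi> by simp
    next
      case True
      let ?S = "(\<lambda>i. \<phi> i (p i ?X)) ` I"
      have B: "B ?X = {}"
      proof -
        have "p i ?X \<in> D i" if "i \<in> I" for i using off[OF that] on True by (cases "i = j") auto
        then show ?thesis by (auto simp: B_def)
      qed
      \<comment> \<open>Here \<open>\<psi>\<close> is the meet over \<open>I\<close>. Its members
        are \<open>\<phi> j x\<close>, at index \<open>j\<close>, and
        \<open>\<phi> j (\<rho> j x)\<close> at any other index. Since \<open>x\<close> \<le>
        \<open>\<rho> j x\<close>, the member \<open>\<phi> j x\<close> is the least, so it is the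
        meet.\<close>
      have x_le: "x \<sqsubseteq>\<^bsub>L j\<^esub> \<rho> j x"
        using retraction_above[OF bspec[OF sub j(1)] bspec[OF conv j(1)] bspec[OF retr j(1)] j(2)] True
        unfolding D_def by blast
      have lower: "\<phi> j x \<sqsubseteq>\<^bsub>M\<^esub> \<phi> i (p i ?X)" if i: "i \<in> I" for i
      proof (cases "i = j")
        case True
        then show ?thesis using on lattice_le_refl[OF M \<phi>x] by simp
      next
        case False
        then have "\<phi> i (p i ?X) = \<phi> j (\<rho> j x)"
          using p_var[OF i j] \<phi>_eq[OF i j(1) r] by simp
        then show ?thesis
          using isotone_mapD(2)[OF bspec[OF \<phi> j(1)] j(2) subsetD[OF KL[OF j(1)] r] x_le] by simp
      qed
      have S: "?S \<subseteq> carrier M" "?S \<noteq> {}" "\<phi> j x \<in> ?S" using cl X on j by force+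
      note inf = finite_inf[OF M fin[OF X] S(1,2)]
      have "\<Sqinter>\<^bsub>M\<^esub>?S = \<phi> j x"
        by (rule lattice_le_antisym[OF M inf(2)[OF S(3)] inf(3)[OF \<phi>x] inf(1) \<phi>x])
          (use lower in blast)
      then show ?thesis using B by (simp add: \<psi>_def join_or_meet_def)
    qed
  qed
  ultimately show ?thesis using that by blast
qed

section \<open>Transfer to an arbitrary free amalgam\<close>

text \<open>Universality of \<open>F\<close> gives a homomorphism \<open>h\<close> to the term
  lattice commuting with the canonical maps. Composing \<open>h\<close> with the extension built
  there gives the extension on \<open>F\<close>.\<close>

lemma free_amalgam_isotone_extension:
  fixes L :: "'i \<Rightarrow> 'a gorder" and F :: "'l gorder" and M :: "'m gorder"
  assumes sub: "\<forall>i\<in>I. sublattice K (L i)"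
    and disj: "disjoint_except_for I L K"
    and conv: "\<forall>i\<in>I. convex_in K (L i)"
    and retr: "\<forall>i\<in>I. lattice_retraction (L i) K (\<rho> i)"
    and V: "\<forall>i\<in>I. in_variety V (L i)"
    and F: "free_amalgam V I L K F \<eta>"
    and M: "is_lattice M"
    and \<phi>: "\<forall>i\<in>I. isotone_map (L i) M (\<phi> i)" and ag: "agree_on I (carrier K) \<phi>"
  shows "\<exists>\<psi>. isotone_map F M \<psi> \<and> (\<forall>i\<in>I. \<forall>x\<in>carrier (L i). \<psi> (\<eta> i x) = \<phi> i x)"
proof (cases "I = {}")
  case True
  \<comment> \<open>Every term contains a variable, so for empty \<open>I\<close> the term lattice
    would have no elements. The extension condition is then vacuous, and a constant map
    serves.\<close>
  obtain m where m: "m \<in> carrier M" and latM: "lattice M" using M by (auto simp: is_lattice_def)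
  have "lattice F" using F by (simp add: free_amalgam_def in_variety_def is_lattice_def)
  then have "isotone_map F M (\<lambda>_. m)"
    using m latM lattice_le_refl[OF latM m] by (auto intro: isotone_mapI)
  then show ?thesis using True by blast
next
  case False
  have latM: "lattice M" using M by (simp add: is_lattice_def)
  have is_lat: "\<forall>i\<in>I. is_lattice (L i)" using sub by (simp add: sublattice_def)
  let ?T = "term_lattice V I L" and ?\<tau> = "\<lambda>(i::'i) x. tclass V I L (LVar x)"
  have T: "in_variety V ?T" "\<forall>i\<in>I. lattice_hom (L i) ?T (?\<tau> i)" "agree_on I (carrier K) ?\<tau>"
    using free_amalgam_exists[OF False is_lat disj, of V] by (auto simp: free_amalgam_def)
  have univ: "universal_into TYPE('a lterm set) V I L K F \<eta>"
    using F by (simp add: free_amalgam_def)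
  obtain h where h: "lattice_hom F ?T h"
    "\<forall>i\<in>I. \<forall>x\<in>carrier (L i). h (\<eta> i x) = tclass V I L (LVar x)"
    by (rule universal_into_extend[OF univ T])
  obtain \<psi> where \<psi>: "isotone_map ?T M \<psi>"
    "\<forall>i\<in>I. \<forall>x\<in>carrier (L i). \<psi> (tclass V I L (LVar x)) = \<phi> i x"
    by (rule term_lattice_isotone_extension[OF False sub disj conv retr V latM \<phi> ag])
  show ?thesis
    using isotone_map_comp_hom[OF h(1) \<psi>(1) latM] h(2) \<psi>(2)
    by (intro exI[of _ "\<lambda>x. \<psi> (h x)"]) simp
qed

text \<open>A comparison within one \<open>L i\<close> is a single step of the relation that
  generates the amalgam order.\<close>

lemma isotone_map_amalgam_restrict:
  assumes f: "isotone_map (amalgam I L) M f" and i: "i \<in> I" and L: "lattice (L i)"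
    and M: "lattice M"
  shows "isotone_map (L i) M f"
proof (rule isotone_mapI[OF L M])
  have car: "x \<in> carrier (amalgam I L)" if "x \<in> carrier (L i)" for x
    using that i by (auto simp: amalgam_def)
  then show "f x \<in> carrier M" if "x \<in> carrier (L i)" for x using that isotone_mapD(1)[OF f] by blast
  show "f x \<sqsubseteq>\<^bsub>M\<^esub> f y" if xy: "x \<in> carrier (L i)" "y \<in> carrier (L i)" "x \<sqsubseteq>\<^bsub>L i\<^esub> y" for x y
  proof (rule isotone_mapD(2)[OF f car[OF xy(1)] car[OF xy(2)]])
    show "x \<sqsubseteq>\<^bsub>amalgam I L\<^esub> y" using xy i by (auto simp: amalgam_def intro!: r_into_trancl)
  qed
qed

theorem theorem10:
  fixes I :: "'i set"
    and L :: "'i \<Rightarrow> 'a gorder"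
    and K :: "'a gorder"
    and \<rho> :: "'i \<Rightarrow> 'a \<Rightarrow> 'a"
    and V :: "(nat lterm \<times> nat lterm) set"
    and F :: "'l gorder"
    and \<eta> :: "'i \<Rightarrow> 'a \<Rightarrow> 'l"
    and M :: "'m gorder"
  assumes "\<And>i. i \<in> I \<Longrightarrow> sublattice K (L i)"
    and "disjoint_except_for I L K"
    and "\<And>i. i \<in> I \<Longrightarrow> convex_in K (L i)"
    and "\<And>i. i \<in> I \<Longrightarrow> lattice_retraction (L i) K (\<rho> i)"
    and "\<And>i. i \<in> I \<Longrightarrow> in_variety V (L i)"
    and "free_amalgam V I L K F \<eta>"
    and "is_lattice M"
  shows "(\<forall>\<phi>. (\<forall>i\<in>I. isotone_map (L i) M (\<phi> i)) \<and> agree_on I (carrier K) \<phi> \<longrightarrow>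
           (\<exists>\<psi>. isotone_map F M \<psi> \<and> (\<forall>i\<in>I. \<forall>x\<in>carrier (L i). \<psi> (\<eta> i x) = \<phi> i x))) \<and>
         (\<forall>f. isotone_map (amalgam I L) M f \<longrightarrow>
           (\<exists>\<psi>. isotone_map F M \<psi> \<and> (\<forall>i\<in>I. \<forall>x\<in>carrier (L i). \<psi> (\<eta> i x) = f x)))"
proof (intro conjI allI impI)
  have H: "\<forall>i\<in>I. sublattice K (L i)" "\<forall>i\<in>I. convex_in K (L i)"
    "\<forall>i\<in>I. lattice_retraction (L i) K (\<rho> i)" "\<forall>i\<in>I. in_variety V (L i)"
    using assms(1,3-5) by blast+
  note ext = free_amalgam_isotone_extension[OF H(1) assms(2) H(2-4) assms(6,7)]
  show "\<exists>\<psi>. isotone_map F M \<psi> \<and> (\<forall>i\<in>I. \<forall>x\<in>carrier (L i). \<psi> (\<eta> i x) = \<phi> i x)"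
    if "(\<forall>i\<in>I. isotone_map (L i) M (\<phi> i)) \<and> agree_on I (carrier K) \<phi>" for \<phi>
    using ext that by blast
  show "\<exists>\<psi>. isotone_map F M \<psi> \<and> (\<forall>i\<in>I. \<forall>x\<in>carrier (L i). \<psi> (\<eta> i x) = f x)"
    if f: "isotone_map (amalgam I L) M f" for f
  \<comment> \<open>The map \<open>f\<close> on the union is read as the constant family, which
    agrees on \<open>K\<close> trivially.\<close>
  proof (rule ext[of "\<lambda>_. f"])
    show "\<forall>i\<in>I. isotone_map (L i) M f"
      using isotone_map_amalgam_restrict[OF f] sublatticeD(2)[OF assms(1)] assms(7)
      by (auto simp: is_lattice_def)
  qed (simp add: agree_on_def)
qed

end
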